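(* Let $r, s, t$ be positive integers. If $\mathcal{B}$ and $\mathcal{B}'$ are valid opposing orientations of $B_r$ and $B_s$ respectively, then $\{\mathcal{B}, \mathcal{B}', TT_t\}$ is $\vec{\chi}$-finite.
   Context: All digraphs are finite, loopless, and between any two distinct vertices at most one of the two possible arcs is present. A digraph $D$ is $H$-free if no induced subdigraph is isomorphic to $H$, and $\mathcal{F}$-free if $H$-free for all $H\in\mathcal{F}$. The dichromatic number $\vec{\chi}(D)$ is the least $k$ such that $V(D)$ can be partitioned into $k$ sets each inducing an acyclic subdigraph. A finite family $\mathcal{F}$ is $\vec{\chi}$-finite if there is $c$ such that every $\mathcal{F}$-free digraph has dichromatic number at most $c$. $TT_t$ is the transitive (acyclic) tournament on $t$ vertices. For an integer $r\ge 1$, the $r$-broom $B_r$ is the undirected graph with vertex set $\{v_1,v_2,v_3,w_1,\dots,w_r\}$ and edges $v_1v_2$, $v_2v_3$, $v_3w_1,\dots,v_3w_r$. An orientation $\mathcal{B}$ of $B_r$ is valid if either all arcs $v_3w_1,\dots,v_3w_r$ are present or all arcs $w_1v_3,\dots,w_rv_3$ are present. An orientation $\mathcal{B}$ of $B_r$ and an orientation $\mathcal{B}'$ of $B_s$ are opposing if $v_2v_3$ is an arc of $\mathcal{B}$ and $v_3v_2$ is an arc of $\mathcal{B}'$. *)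

theory Defs
  imports "Graph_Theory.Graph_Theory" "HOL-Library.Disjoint_Sets"
begin

text \<open>
  \<^locale>\<open>pair_digraph\<close> already demands finiteness and excludes loops and parallel arcs, but it
  still admits a pair of opposite arcs.
\<close>

locale oriented_digraph = pair_digraph +
  assumes no_digon: "(u, v) \<in> parcs G \<Longrightarrow> (v, u) \<notin> parcs G"

text \<open>
  Undirected graphs are symmetric digraphs, as everywhere in \<^theory>\<open>Graph_Theory.Graph_Theory\<close>;
  \<^const>\<open>mk_symmetric\<close> yields the underlying undirected graph of a digraph.
\<close>

definition orientation_of :: "'a pair_pre_digraph \<Rightarrow> 'a pair_pre_digraph \<Rightarrow> bool" where
  "orientation_of D G \<longleftrightarrow> oriented_digraph D \<and> mk_symmetric (with_proj D) = G"

definition H_free :: "'a pair_pre_digraph \<Rightarrow> 'b pair_pre_digraph \<Rightarrow> bool" where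
  "H_free D H \<longleftrightarrow>
    \<not> (\<exists>D'. induced_subgraph D' (with_proj D) \<and> digraph_iso D' (with_proj H))"

definition family_free :: "'a pair_pre_digraph \<Rightarrow> 'b pair_pre_digraph set \<Rightarrow> bool" where
  "family_free D F \<longleftrightarrow> (\<forall>H\<in>F. H_free D H)"

definition dichromatic_number :: "'a pair_pre_digraph \<Rightarrow> nat" where
  "dichromatic_number D =
    (LEAST k. \<exists>P. partition_on (pverts D) P \<and> card P = k \<and>
      (\<forall>S\<in>P. acyclic (arcs_ends (with_proj D \<restriction> S))))"

text \<open>
  A definition cannot quantify over all vertex types; since every finite digraph is isomorphic to
  one whose vertices are natural numbers, quantifying over the latter loses nothing: lemma
  dichromatic_finite_any_type transfers the bound to an arbitrary vertex type.
\<close>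

definition dichromatic_finite :: "'b pair_pre_digraph set \<Rightarrow> bool" where
  "dichromatic_finite F \<longleftrightarrow>
    finite F \<and>
    (\<exists>c. \<forall>D :: nat pair_pre_digraph.
      oriented_digraph D \<and> family_free D F \<longrightarrow> dichromatic_number D \<le> c)"

lemma dichromatic_finite_any_type:
  assumes "dichromatic_finite F"
  obtains c where "\<And>D :: 'a pair_pre_digraph.
    oriented_digraph D \<Longrightarrow> family_free D F \<Longrightarrow> dichromatic_number D \<le> c"
proof -
  from assms obtain c where c: "\<And>D :: nat pair_pre_digraph.
      oriented_digraph D \<Longrightarrow> family_free D F \<Longrightarrow> dichromatic_number D \<le> c"
    unfolding dichromatic_finite_def by blast
  have "dichromatic_number D \<le> c" if D: "oriented_digraph D" "family_free D F"
    for D :: "'a pair_pre_digraph"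
  proof -
    interpret oriented_digraph D by (rule D)
    obtain f :: "'a \<Rightarrow> nat" where f: "inj_on f (pverts D)"
      using finite_imp_inj_to_nat_seg[OF pair_finite_verts] by blast
    define E where "E = \<lparr>pverts = f ` pverts D, parcs = map_prod f f ` parcs D\<rparr>"
    define hom where "hom = \<lparr>iso_verts = f, iso_arcs = map_prod f f, iso_head = snd, iso_tail = fst\<rparr>"
    have arc_eq: "(f u, f v) \<in> parcs E \<longleftrightarrow> (u, v) \<in> parcs D"
      if "u \<in> pverts D" "v \<in> pverts D" for u v
    proof
      assume "(f u, f v) \<in> parcs E"
      then obtain a b where ab: "(a, b) \<in> parcs D" "f u = f a" "f v = f b"
        by (auto simp: E_def)
      then have "u = a" "v = b"
        using that in_arcsD1[OF ab(1)] in_arcsD2[OF ab(1)] f by (blast dest: inj_onD)+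
      with ab show "(u, v) \<in> parcs D" by simp
    qed (force simp: E_def)
    have hom: "pre_digraph.digraph_isomorphism (with_proj D) hom"
    proof -
      have "inj_on (map_prod f f) (pverts D \<times> pverts D)"
        using f by (simp add: map_prod_inj_on)
      moreover have "parcs D \<subseteq> pverts D \<times> pverts D"
      proof (rule subrelI)
        fix x y assume "(x, y) \<in> parcs D"
        then show "(x, y) \<in> pverts D \<times> pverts D"
          using in_arcsD1[of x y] in_arcsD2[of x y] by simp
      qed
      ultimately have "inj_on (map_prod f f) (parcs D)"
        by (rule inj_on_subset)
      then show ?thesis
        using f by (auto simp: pre_digraph.digraph_isomorphism_def hom_def wf_digraph)
    qed
    have E_app: "with_proj E = app_iso hom (with_proj D)"
      by (simp add: app_iso_def E_def hom_def with_proj_def)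
    have E: "oriented_digraph E"
    proof
      fix e assume "e \<in> parcs E"
      then obtain a b where ab: "e = (f a, f b)" "(a, b) \<in> parcs D" by (auto simp: E_def)
      then have V: "a \<in> pverts D" "b \<in> pverts D" "a \<noteq> b"
        using in_arcsD1 in_arcsD2 no_digon by blast+
      with ab show "fst e \<in> pverts E" "snd e \<in> pverts E" by (simp_all add: E_def)
      from V f ab(1) show "fst e \<noteq> snd e" by (auto dest: inj_onD)
    next
      fix u v assume uv: "(u, v) \<in> parcs E"
      then obtain a b where "u = f a" "v = f b" "(a, b) \<in> parcs D" by (auto simp: E_def)
      then show "(v, u) \<notin> parcs E"
        using arc_eq[of b a] no_digon[of a b] in_arcsD1[of a b] in_arcsD2[of a b] by simp
    qed (simp_all add: E_def pair_finite_verts pair_finite_arcs)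
    have "family_free E F"
      unfolding family_free_def H_free_def
    proof (intro ballI notI)
      fix H assume H: "H \<in> F"
        and "\<exists>G'. induced_subgraph G' (with_proj E) \<and> digraph_iso G' (with_proj H)"
      then obtain G' where G': "induced_subgraph G' (with_proj E)" "digraph_iso G' (with_proj H)"
        by blast
      have sub: "subgraph G' (app_iso hom (with_proj D))"
        using G'(1) by (simp add: induced_subgraph_def E_app)
      define G where "G = app_iso (pre_digraph.inv_iso (with_proj D) hom) G'"
      have GG: "app_iso hom G = G'"
        unfolding G_def by (rule wf_digraph.app_iso_iso_inv_subgraph[OF wf_digraph hom sub])
      have hom_inv: "pre_digraph.digraph_isomorphism (app_iso hom (with_proj D))
          (pre_digraph.inv_iso (with_proj D) hom)"
        by (rule wf_digraph.digraph_isomorphism_invI[OF wf_digraph hom])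
      have subG: "subgraph G (with_proj D)"
        using pre_digraph.subgraph_app_isoI[OF hom_inv sub] hom
        by (simp add: G_def pre_digraph.app_iso_inv)
      have homG: "pre_digraph.digraph_isomorphism G hom"
        by (rule pre_digraph.digraph_isomorphism_subgraphI[OF hom subG])
      have "arcs G = {e \<in> parcs D. fst e \<in> verts G \<and> snd e \<in> verts G}"
      proof (intro equalityI subsetI)
        fix e assume e: "e \<in> arcs G"
        have "wf_digraph G" using subG by (simp add: subgraph_def)
        then have "tail G e \<in> verts G" "head G e \<in> verts G"
          using e by (simp_all add: wf_digraph.wellformed)
        then show "e \<in> {e \<in> parcs D. fst e \<in> verts G \<and> snd e \<in> verts G}"
          using e subG by (auto simp: subgraph_def compatible_def)
      next
        fix e assume e: "e \<in> {e \<in> parcs D. fst e \<in> verts G \<and> snd e \<in> verts G}"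
        have "verts G' = f ` verts G" "arcs G' = map_prod f f ` arcs G"
          using GG by (auto simp: hom_def)
        then have "map_prod f f e \<in> map_prod f f ` arcs G"
          using G'(1) e by (cases e) (auto simp: induced_subgraph_def E_def)
        moreover have "inj_on (map_prod f f) (parcs D)"
          using hom by (simp add: pre_digraph.digraph_isomorphism_def hom_def)
        moreover have "arcs G \<subseteq> parcs D"
          using subG by (simp add: subgraph_def)
        ultimately show "e \<in> arcs G"
          using e by (simp add: inj_on_image_mem_iff)
      qed
      then have "induced_subgraph G (with_proj D)"
        using subG by (simp add: induced_subgraph_def)
      moreover have "digraph_iso G (with_proj H)"
        using homG GG G'(2) digraph_iso_trans by (metis digraph_iso_def)
      ultimately show False
        using D(2) H by (auto simp: family_free_def H_free_def)
    qed
    with E have "dichromatic_number E \<le> c" by (rule c)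
    moreover have "dichromatic_number D \<le> dichromatic_number E"
    proof -
      define Q where "Q = (\<lambda>k. \<exists>P. partition_on (pverts E) P \<and> card P = k \<and>
        (\<forall>S\<in>P. acyclic (arcs_ends (with_proj E \<restriction> S))))"
      interpret E: oriented_digraph E by (rule E)
      have "partition_on (pverts E) ((\<lambda>v. {v}) ` pverts E)"
        by (auto simp: partition_on_def disjoint_def)
      moreover have "acyclic (arcs_ends (with_proj E \<restriction> {v}))" for v
      proof -
        have "arcs_ends (with_proj E \<restriction> {v}) = {}"
          using E.no_digon[of v v] by (auto simp: arcs_ends_conv)
        then show ?thesis by (simp add: acyclic_def)
      qed
      ultimately have "Q (card ((\<lambda>v. {v}) ` pverts E))" unfolding Q_def by blast
      then have "Q (dichromatic_number E)"
        unfolding dichromatic_number_def Q_def[symmetric] by (rule LeastI)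
      then obtain P where P: "partition_on (pverts E) P" "card P = dichromatic_number E"
        "\<And>S. S \<in> P \<Longrightarrow> acyclic (arcs_ends (with_proj E \<restriction> S))"
        unfolding Q_def by blast
      define g where "g = the_inv_into (pverts D) f"
      have g: "inj_on g (pverts E)" "g ` pverts E = pverts D"
        "\<And>u. u \<in> pverts D \<Longrightarrow> g (f u) = u" "\<And>x. x \<in> pverts E \<Longrightarrow> f (g x) = x"
        using f inj_on_the_inv_into[OF f]
        by (auto simp: g_def E_def the_inv_into_f_f image_image)
      define R where "R = (`) g ` P"
      have "R - {{}} = R"
        using P(1) by (auto simp: R_def partition_on_def)
      then have "partition_on (pverts D) R"
        using partition_on_inj_image[OF P(1) g(1)] g(2) by (simp add: R_def)
      moreover have "card R = dichromatic_number E"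
      proof -
        have "inj_on ((`) g) P"
          using inj_on_image_Pow[OF g(1)] P(1)
          by (auto simp: partition_on_def intro: inj_on_subset)
        then show ?thesis by (simp add: R_def card_image P(2))
      qed
      moreover have "acyclic (arcs_ends (with_proj D \<restriction> S))" if "S \<in> R" for S
      proof -
        from that obtain T where T: "T \<in> P" "S = g ` T" by (auto simp: R_def)
        then have TE: "T \<subseteq> pverts E" using P(1) by (auto simp: partition_on_def)
        have "arcs_ends (with_proj D \<restriction> S) \<subseteq> inv_image (arcs_ends (with_proj E \<restriction> T)) f"
        proof
          fix e assume "e \<in> arcs_ends (with_proj D \<restriction> S)"
          then obtain x y where xy: "e = (x, y)" "(x, y) \<in> parcs D" "x \<in> S" "y \<in> S"
            by (cases e) (auto simp: arcs_ends_conv)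
          then have "f x \<in> T" "f y \<in> T" using T(2) TE g(4) by auto
          moreover have "(f x, f y) \<in> parcs E" using xy(2) by (force simp: E_def)
          ultimately show "e \<in> inv_image (arcs_ends (with_proj E \<restriction> T)) f"
            using xy(1) by (force simp: arcs_ends_conv)
        qed
        moreover have "acyclic (inv_image (arcs_ends (with_proj E \<restriction> T)) f)"
        proof -
          have "(f x, f y) \<in> (arcs_ends (with_proj E \<restriction> T))\<^sup>+"
            if "(x, y) \<in> (inv_image (arcs_ends (with_proj E \<restriction> T)) f)\<^sup>+" for x y
            using that by induction (auto intro: trancl_into_trancl)
          then show ?thesis using P(3)[OF T(1)] unfolding acyclic_def by blast
        qed
        ultimately show ?thesis by (rule acyclic_subset[rotated])
      qed
      ultimately show ?thesis
        unfolding dichromatic_number_def[of D] by (intro Least_le) blast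
    qed
    ultimately show ?thesis by simp
  qed
  then show ?thesis by (rule that)
qed

definition TT :: "nat \<Rightarrow> nat pair_pre_digraph" where
  "TT t = \<lparr>pverts = {1..t}, parcs = {(i, j). 1 \<le> i \<and> i < j \<and> j \<le> t}\<rparr>"

abbreviation (input) broom_v1 :: nat where "broom_v1 \<equiv> 1"
abbreviation (input) broom_v2 :: nat where "broom_v2 \<equiv> 2"
abbreviation (input) broom_v3 :: nat where "broom_v3 \<equiv> 3"
abbreviation (input) broom_w :: "nat \<Rightarrow> nat" where "broom_w i \<equiv> 3 + i"

definition broom :: "nat \<Rightarrow> nat pair_pre_digraph" where
  "broom r = \<lparr>pverts = {broom_v1, broom_v2, broom_v3} \<union> broom_w ` {1..r},
     parcs = {(broom_v1, broom_v2), (broom_v2, broom_v1), (broom_v2, broom_v3), (broom_v3, broom_v2)}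
       \<union> (\<Union>i\<in>{1..r}. {(broom_v3, broom_w i), (broom_w i, broom_v3)})\<rparr>"

definition valid_orientation :: "nat \<Rightarrow> nat pair_pre_digraph \<Rightarrow> bool" where
  "valid_orientation r B \<longleftrightarrow> orientation_of B (broom r) \<and>
    ((\<forall>i\<in>{1..r}. (broom_v3, broom_w i) \<in> parcs B) \<or> (\<forall>i\<in>{1..r}. (broom_w i, broom_v3) \<in> parcs B))"

definition opposing :: "nat pair_pre_digraph \<Rightarrow> nat pair_pre_digraph \<Rightarrow> bool" where
  "opposing B B' \<longleftrightarrow> (broom_v2, broom_v3) \<in> parcs B \<and> (broom_v3, broom_v2) \<in> parcs B'"

end

theory Submission
  imports Defs "HOL-Library.Ramsey"
begin

text \<open>
  By induction on \<open>t\<close>, closed neighbourhoods have bounded dichromatic number \<open>h\<close>, and one may assume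
  that the digraph is strongly connected. By Ramsey's theorem, forbidding a broom makes
  \<open>N(v\<^sub>3) - N[v\<^sub>1] - N[v\<^sub>2]\<close> small, in the relevant direction, for every path \<open>v\<^sub>1v\<^sub>2v\<^sub>3\<close> that could
  start the broom. A set \<open>S\<close> is dicoloured by peeling: it suffices to find, in every nonempty subset
  \<open>S'\<close>, a nonempty \<open>Q\<close> of bounded dichromatic number all of whose vertices have few out-neighbours
  or few in-neighbours in \<open>S' - Q\<close>. Such a \<open>Q\<close> is found near a connected structure chosen
  according to the orientations of the brooms. If \<open>v\<^sub>1v\<^sub>2\<close>, read from the point of view of the arc
  \<open>v\<^sub>2v\<^sub>3\<close>, is not directed along it in both brooms, take the neighbourhood of a shortest walk that
  leaves and re-enters the set of vertices without neighbours in \<open>S'\<close>. Otherwise both brooms contain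
  a directed path \<open>v\<^sub>1v\<^sub>2v\<^sub>3\<close> or its reverse; if a star continues this direction, take the
  out-neighbourhood of a set closed under adding ears with at most two interior vertices, and if not,
  take the neighbourhood of a saturated complete bipartite subgraph or, when there is none, a single
  closed neighbourhood.
\<close>

section \<open>Dicolourings and peeling\<close>

text \<open>With no arc from \<open>W\<close> back to \<open>U\<close>, a closed walk that meets
  \<open>W\<close> stays in \<open>W\<close>, and one that avoids \<open>W\<close> stays in
  \<open>U\<close>.\<close>

lemma acyclic_two_parts:
  assumes "acyclic (M \<inter> U \<times> U)" "acyclic (M \<inter> W \<times> W)"
    and M: "M \<subseteq> (U \<union> W) \<times> (U \<union> W)" and WU: "M \<inter> W \<times> U = {}"
  shows "acyclic M"
proof -
  have forward: "y \<in> W \<and> (x, y) \<in> (M \<inter> W \<times> W)\<^sup>+" if "(x, y) \<in> M\<^sup>+" "x \<in> W" for x y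
    using that
  proof (induction rule: trancl_induct)
    case (base y)
    then show ?case using M WU by blast
  next
    case (step y z)
    then have "(y, z) \<in> M \<inter> W \<times> W" using M WU by blast
    with step show ?case by (blast intro: trancl_into_trancl)
  qed
  have backward: "x \<notin> W \<and> (x, y) \<in> (M \<inter> U \<times> U)\<^sup>+" if "(x, y) \<in> M\<^sup>+" "y \<notin> W" for x y
    using that
  proof (induction rule: converse_trancl_induct)
    case (base x)
    then have "(x, y) \<in> M \<inter> U \<times> U" "x \<notin> W" using M WU by blast+
    then show ?case by blast
  next
    case (step x x')
    then have "(x, x') \<in> M \<inter> U \<times> U" "x \<notin> W" using M WU by blast+
    with step show ?case by (blast intro: trancl_into_trancl2)
  qed
  show ?thesis
    unfolding acyclic_def
  proof (intro allI notI)
    fix x assume "(x, x) \<in> M\<^sup>+"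
    with forward[of x x] backward[of x x] assms(1,2) show False
      unfolding acyclic_def by blast
  qed
qed

text \<open>A colouring function instead of a partition: classes may be empty, so the bound is
  monotone in \<open>c\<close>, and one acyclicity condition on the monochromatic arcs covers all
  classes.\<close>

definition dicol :: "'a rel \<Rightarrow> 'a set \<Rightarrow> nat \<Rightarrow> bool" where
  "dicol E S c \<longleftrightarrow>
    (\<exists>f. (\<forall>v\<in>S. f v < c) \<and> acyclic {(u, v) \<in> E. u \<in> S \<and> v \<in> S \<and> f u = f v})"

lemma dicol_mono:
  assumes "dicol E S c" "T \<subseteq> S" "c \<le> d"
  shows "dicol E T d"
proof -
  obtain f where f: "\<forall>v\<in>S. f v < c" "acyclic {(u, v) \<in> E. u \<in> S \<and> v \<in> S \<and> f u = f v}"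
    using assms(1) unfolding dicol_def by blast
  have "acyclic {(u, v) \<in> E. u \<in> T \<and> v \<in> T \<and> f u = f v}"
    using f(2) by (rule acyclic_subset) (use assms(2) in auto)
  then show ?thesis unfolding dicol_def using f(1) assms(2,3) by (intro exI[of _ f]) fastforce
qed

lemma dicol_cong:
  assumes "E \<inter> S \<times> S = F \<inter> S \<times> S"
  shows "dicol E S c \<longleftrightarrow> dicol F S c"
proof -
  have "{(u, v) \<in> E. u \<in> S \<and> v \<in> S \<and> f u = f v} = {(u, v) \<in> F. u \<in> S \<and> v \<in> S \<and> f u = f v}"
    for f :: "'a \<Rightarrow> nat"
    using assms by blast
  then show ?thesis unfolding dicol_def by simp
qed

lemma dicol_converse [simp]: "dicol (E\<inverse>) S c \<longleftrightarrow> dicol E S c"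
proof -
  have "acyclic {(u, v) \<in> E\<inverse>. u \<in> S \<and> v \<in> S \<and> f u = f v}
      \<longleftrightarrow> acyclic {(u, v) \<in> E. u \<in> S \<and> v \<in> S \<and> f u = f v}" for f :: "'a \<Rightarrow> nat"
  proof -
    have "{(u, v) \<in> E\<inverse>. u \<in> S \<and> v \<in> S \<and> f u = f v}
        = {(u, v) \<in> E. u \<in> S \<and> v \<in> S \<and> f u = f v}\<inverse>" by auto
    then show ?thesis by simp
  qed
  then show ?thesis unfolding dicol_def by simp
qed

lemma dicol_empty [simp]: "dicol E {} c"
  unfolding dicol_def by (auto simp: acyclic_def)

lemma dicol_singleton:
  fixes E :: "'a rel"
  assumes "irrefl E"
  shows "dicol E {v} 1"
proof -
  have "{(a, b) \<in> E. a \<in> {v} \<and> b \<in> {v} \<and> (0::nat) = 0} = {}"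
    using assms by (auto simp: irrefl_def)
  moreover have "acyclic ({} :: 'a rel)" by (simp add: acyclic_def)
  ultimately have "acyclic {(a, b) \<in> E. a \<in> {v} \<and> b \<in> {v} \<and> (0::nat) = 0}"
    by (rule ssubst)
  then show ?thesis unfolding dicol_def by (intro exI[of _ "\<lambda>_. 0"]) simp
qed

text \<open>Both sides can share one palette, since no cycle crosses between them. This reduces the
  problem to strongly connected digraphs at no cost in colours.\<close>

lemma dicol_Un_same:
  assumes "dicol E U c" "dicol E W c" "E \<inter> W \<times> U = {}"
  shows "dicol E (U \<union> W) c"
proof -
  obtain f where f: "\<forall>v\<in>U. f v < c" "acyclic {(u, v) \<in> E. u \<in> U \<and> v \<in> U \<and> f u = f v}"
    using assms(1) unfolding dicol_def by blast
  obtain g where g: "\<forall>v\<in>W. g v < c" "acyclic {(u, v) \<in> E. u \<in> W \<and> v \<in> W \<and> g u = g v}"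
    using assms(2) unfolding dicol_def by blast
  define k where "k v = (if v \<in> W then g v else f v)" for v
  let ?M = "{(u, v) \<in> E. u \<in> U \<union> W \<and> v \<in> U \<union> W \<and> k u = k v}"
  have "acyclic ?M"
  proof (rule acyclic_two_parts)
    show "acyclic (?M \<inter> (U - W) \<times> (U - W))"
      using f(2) by (rule acyclic_subset) (auto simp: k_def)
    show "acyclic (?M \<inter> W \<times> W)"
      using g(2) by (rule acyclic_subset) (auto simp: k_def)
    show "?M \<subseteq> (U - W \<union> W) \<times> (U - W \<union> W)" by auto
    show "?M \<inter> W \<times> (U - W) = {}" using assms(3) by auto
  qed
  moreover have "\<forall>v\<in>U \<union> W. k v < c" using f(1) g(1) by (auto simp: k_def)
  ultimately show ?thesis unfolding dicol_def by blast
qed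

lemma dicol_Un:
  assumes "dicol E U c" "dicol E W d"
  shows "dicol E (U \<union> W) (c + d)"
proof -
  obtain f where f: "\<forall>v\<in>U. f v < c" "acyclic {(u, v) \<in> E. u \<in> U \<and> v \<in> U \<and> f u = f v}"
    using assms(1) unfolding dicol_def by blast
  obtain g where g: "\<forall>v\<in>W. g v < d" "acyclic {(u, v) \<in> E. u \<in> W \<and> v \<in> W \<and> g u = g v}"
    using assms(2) unfolding dicol_def by blast
  define k where "k v = (if v \<in> U then f v else c + g v)" for v
  let ?M = "{(u, v) \<in> E. u \<in> U \<union> W \<and> v \<in> U \<union> W \<and> k u = k v}"
  have "acyclic ?M"
  proof (rule acyclic_two_parts)
    show "acyclic (?M \<inter> U \<times> U)"
      using f(2) by (rule acyclic_subset) (auto simp: k_def)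
    show "acyclic (?M \<inter> (W - U) \<times> (W - U))"
      using g(2) by (rule acyclic_subset) (auto simp: k_def)
    show "?M \<subseteq> (U \<union> (W - U)) \<times> (U \<union> (W - U))" by auto
    show "?M \<inter> (W - U) \<times> U = {}" using f(1) by (fastforce simp: k_def)
  qed
  moreover have "\<forall>v\<in>U \<union> W. k v < c + d" using f(1) g(1) by (auto simp: k_def)
  ultimately show ?thesis unfolding dicol_def by blast
qed

lemma dicol_UN:
  assumes "finite I" "\<And>i. i \<in> I \<Longrightarrow> dicol E (S i) c"
  shows "dicol E (\<Union>i\<in>I. S i) (card I * c)"
  using assms
proof (induction I rule: finite_induct)
  case (insert i I)
  then have "dicol E (S i \<union> (\<Union>i\<in>I. S i)) (c + card I * c)" by (intro dicol_Un) auto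
  with insert show ?case by simp
qed simp

text \<open>Colours below \<open>c * R\<close> are read as a quotient and a residue modulo
  \<open>R\<close>. On \<open>Q\<close> the quotient repeats a colouring of \<open>Q\<close>, and
  the residue avoids those of all out-neighbours in \<open>A - Q\<close>; hence no monochromatic arc
  goes from \<open>Q\<close> to \<open>A - Q\<close>.\<close>

lemma dicol_add_sparse:
  assumes A: "dicol E A (c * R)" and Q: "dicol E Q c" and fin: "finite E"
    and sparse: "\<And>z. z \<in> Q \<Longrightarrow> card (E `` {z} \<inter> (A - Q)) < R"
  shows "dicol E (A \<union> Q) (c * R)"
proof -
  obtain f where f: "\<forall>v\<in>A. f v < c * R" "acyclic {(u, v) \<in> E. u \<in> A \<and> v \<in> A \<and> f u = f v}"
    using A unfolding dicol_def by blast
  obtain g where g: "\<forall>v\<in>Q. g v < c" "acyclic {(u, v) \<in> E. u \<in> Q \<and> v \<in> Q \<and> g u = g v}"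
    using Q unfolding dicol_def by blast
  have "\<exists>s<R. s \<notin> (\<lambda>w. f w mod R) ` (E `` {z} \<inter> (A - Q))" if "z \<in> Q" for z
  proof -
    have fin': "finite (E `` {z} \<inter> (A - Q))" using fin by (simp add: finite_Image)
    then have "card ((\<lambda>w. f w mod R) ` (E `` {z} \<inter> (A - Q))) < card {..<R}"
      using sparse[OF that] card_image_le[OF fin', of "\<lambda>w. f w mod R"] by simp
    then have "\<not> {..<R} \<subseteq> (\<lambda>w. f w mod R) ` (E `` {z} \<inter> (A - Q))"
      using card_mono[OF finite_imageI[OF fin'], of "{..<R}" "\<lambda>w. f w mod R"] by fastforce
    then show ?thesis by blast
  qed
  then obtain s where s: "\<And>z. z \<in> Q \<Longrightarrow> s z < R"
      "\<And>z. z \<in> Q \<Longrightarrow> s z \<notin> (\<lambda>w. f w mod R) ` (E `` {z} \<inter> (A - Q))"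
    by metis
  define k where "k v = (if v \<in> Q then g v * R + s v else f v)" for v
  let ?M = "{(u, v) \<in> E. u \<in> A \<union> Q \<and> v \<in> A \<union> Q \<and> k u = k v}"
  have div: "k v div R = g v" and mod: "k v mod R = s v" if "v \<in> Q" for v
    using s(1)[OF that] that by (simp_all add: k_def)
  have same: "g u = g v" if "k u = k v" "u \<in> Q" "v \<in> Q" for u v
    using that div[of u] div[of v] by simp
  have "acyclic ?M"
  proof (rule acyclic_two_parts)
    show "acyclic (?M \<inter> (A - Q) \<times> (A - Q))"
      using f(2) by (rule acyclic_subset) (auto simp: k_def)
    show "acyclic (?M \<inter> Q \<times> Q)"
      using g(2) by (rule acyclic_subset) (auto dest: same)
    show "?M \<subseteq> (A - Q \<union> Q) \<times> (A - Q \<union> Q)" by auto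
    show "?M \<inter> Q \<times> (A - Q) = {}"
    proof (rule ccontr)
      assume "?M \<inter> Q \<times> (A - Q) \<noteq> {}"
      then obtain u v where uv: "(u, v) \<in> E" "u \<in> Q" "v \<in> A - Q" "k u = k v" by blast
      then have "s u = f v mod R" using mod[of u] by (simp add: k_def)
      with uv s(2)[of u] show False by blast
    qed
  qed
  moreover have "k v < c * R" if v: "v \<in> A \<union> Q" for v
  proof (cases "v \<in> Q")
    case True
    then have "g v * R + s v < (g v + 1) * R" using s(1) by simp
    also have "\<dots> \<le> c * R" using g(1) True by (intro mult_right_mono) auto
    finally show ?thesis using True by (simp add: k_def)
  qed (use f(1) v in \<open>auto simp: k_def\<close>)
  ultimately show ?thesis unfolding dicol_def by blast
qed

section \<open>Peeling off sets of thin vertices\<close>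

definition thin :: "'a rel \<Rightarrow> nat \<Rightarrow> 'a \<Rightarrow> 'a set \<Rightarrow> bool" where
  "thin E R z S \<longleftrightarrow> card (E `` {z} \<inter> S) < R \<or> card (E\<inverse> `` {z} \<inter> S) < R"

text \<open>Thinness is required only towards \<open>S - Q\<close>; arcs inside \<open>Q\<close> are
  left to its own colouring.\<close>

definition peelable :: "'a rel \<Rightarrow> nat \<Rightarrow> nat \<Rightarrow> 'a set \<Rightarrow> bool" where
  "peelable E R c S \<longleftrightarrow>
    (\<exists>Q. Q \<subseteq> S \<and> Q \<noteq> {} \<and> dicol E Q c \<and> (\<forall>z\<in>Q. thin E R z (S - Q)))"

lemma thin_converse [simp]: "thin (E\<inverse>) R z S = thin E R z S"
  unfolding thin_def by auto

lemma thin_mono: "thin E R z S \<Longrightarrow> T \<subseteq> S \<Longrightarrow> finite E \<Longrightarrow> thin E R z T"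
  unfolding thin_def
  using card_mono[of "E `` {z} \<inter> S" "E `` {z} \<inter> T"]
    card_mono[of "E\<inverse> `` {z} \<inter> S" "E\<inverse> `` {z} \<inter> T"]
  by (auto simp: finite_Image le_infI2)

lemma peelable_mono: "peelable E R c S \<Longrightarrow> c \<le> d \<Longrightarrow> peelable E R d S"
  unfolding peelable_def by (metis dicol_mono subset_refl)

text \<open>Peel off sets \<open>Q\<close> one after another and split the vertices by whether they have few
  out-neighbours or few in-neighbours among the vertices peeled later. Colouring backwards, each
  vertex avoids the fewer than \<open>R\<close> colours of its later out-neighbours (or in-neighbours), so every
  monochromatic cycle lies in a single \<open>Q\<close>.\<close>

lemma dicol_if_peelable:
  assumes "finite S" "finite E"
    and "\<And>S'. S' \<subseteq> S \<Longrightarrow> S' \<noteq> {} \<Longrightarrow> peelable E R c S'"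
  shows "dicol E S (2 * c * R)"
proof -
  \<comment> \<open>\<open>A\<close> collects the vertices with few out-neighbours peeled later,
    \<open>B\<close> those with few such in-neighbours. Their separate palettes cause the factor 2
    in the bound.\<close>
  have "\<exists>A B. S' = A \<union> B \<and> dicol E A (c * R) \<and> dicol E B (c * R)" if "S' \<subseteq> S" for S'
    using finite_subset[OF that assms(1)] that
  proof (induction S' rule: finite_psubset_induct)
    case (psubset S')
    show ?case
    proof (cases "S' = {}")
      case False
      with assms(3) psubset.prems have "peelable E R c S'" by simp
      then obtain Q where Q: "Q \<subseteq> S'" "Q \<noteq> {}" "dicol E Q c" "\<forall>z\<in>Q. thin E R z (S' - Q)"
        unfolding peelable_def by blast
      have "S' - Q \<subset> S'" "S' - Q \<subseteq> S" using Q(1,2) psubset.prems by auto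
      from psubset.IH[OF this] obtain A B where AB:
        "S' - Q = A \<union> B" "dicol E A (c * R)" "dicol E B (c * R)"
        by blast
      define Qo where "Qo = {z \<in> Q. card (E `` {z} \<inter> (S' - Q)) < R}"
      define Qi where "Qi = {z \<in> Q. card (E\<inverse> `` {z} \<inter> (S' - Q)) < R}"
      have less: "card (F `` {z} \<inter> (X - Y)) < R"
        if "card (F `` {z} \<inter> (S' - Q)) < R" "X \<subseteq> S' - Q" "finite F" for F :: "'a rel" and X Y z
      proof -
        have "card (F `` {z} \<inter> (X - Y)) \<le> card (F `` {z} \<inter> (S' - Q))"
          by (rule card_mono) (use that in \<open>auto simp: finite_Image\<close>)
        with that(1) show ?thesis by simp
      qed
      have "Qo \<subseteq> Q" "Qi \<subseteq> Q" by (auto simp: Qo_def Qi_def)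
      then have Qoi: "dicol E Qo c" "dicol (E\<inverse>) Qi c"
        using Q(3) dicol_mono[OF _ _ order_refl] by auto
      have "A \<subseteq> S' - Q" "B \<subseteq> S' - Q" using AB(1) by auto
      then have "dicol E (A \<union> Qo) (c * R)" "dicol (E\<inverse>) (B \<union> Qi) (c * R)"
        using assms(2) AB(3) dicol_add_sparse[OF AB(2) Qoi(1)] dicol_add_sparse[OF _ Qoi(2)] less
        by (simp_all add: Qo_def Qi_def)
      moreover have "S' = (A \<union> Qo) \<union> (B \<union> Qi)"
        using AB(1) Q(1,4) unfolding thin_def Qo_def Qi_def by blast
      ultimately show ?thesis by (metis dicol_converse)
    next
      case True
      then show ?thesis using dicol_empty by (metis Un_empty)
    qed
  qed
  then obtain A B where "S = A \<union> B" "dicol E A (c * R)" "dicol E B (c * R)" by blast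
  then have "dicol E S (c * R + c * R)" using dicol_Un by blast
  moreover have "c * R + c * R = 2 * c * R" by simp
  ultimately show ?thesis by simp
qed

section \<open>Forbidden brooms\<close>

definition sgn_nbr :: "'a rel \<Rightarrow> bool \<Rightarrow> 'a \<Rightarrow> 'a set" where
  "sgn_nbr E b v = (if b then E `` {v} else E\<inverse> `` {v})"

definition cnbr :: "'a rel \<Rightarrow> 'a \<Rightarrow> 'a set" where
  "cnbr E v = insert v (E `` {v} \<union> E\<inverse> `` {v})"

lemma sgn_nbr_converse [simp]: "sgn_nbr (E\<inverse>) b v = sgn_nbr E (\<not> b) v"
  by (simp add: sgn_nbr_def)

lemma cnbr_converse [simp]: "cnbr (E\<inverse>) v = cnbr E v"
  by (auto simp: cnbr_def)

lemma mem_cnbr: "u \<in> cnbr E v \<longleftrightarrow> u = v \<or> (u, v) \<in> E \<or> (v, u) \<in> E"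
  by (auto simp: cnbr_def)

lemma cnbr_sym: "u \<in> cnbr E v \<longleftrightarrow> v \<in> cnbr E u"
  by (auto simp: cnbr_def)

text \<open>Here \<open>p\<close>, \<open>q\<close>, \<open>z\<close> play the roles of \<open>v\<^sub>1\<close>, \<open>v\<^sub>2\<close>, \<open>v\<^sub>3\<close> in a broom containing the arc
  \<open>v\<^sub>2v\<^sub>3\<close>; \<open>b\<close> tells whether \<open>v\<^sub>2v\<^sub>1\<close> is an arc and \<open>e\<close> whether the star at \<open>v\<^sub>3\<close> points outwards. The
  opposing broom is the same condition on the converse relation.\<close>

definition broomless :: "'a rel \<Rightarrow> nat \<Rightarrow> bool \<Rightarrow> bool \<Rightarrow> bool" where
  "broomless E R b e \<longleftrightarrow>
    (\<forall>p q z. (q, z) \<in> E \<longrightarrow> p \<in> sgn_nbr E b q \<longrightarrow> p \<notin> cnbr E z \<longrightarrow>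
      card (sgn_nbr E e z - cnbr E p - cnbr E q) < R)"

text \<open>The second broom is imposed on the converse relation, so reversing all arcs merely swaps
  \<open>b1\<close>, \<open>e1\<close> with \<open>b2\<close>, \<open>e2\<close> and every result
  has a mirror image. The bound \<open>h\<close> is supplied by the induction on the
  tournament.\<close>

locale broom_free =
  fixes E :: "'a rel" and R h :: nat and b1 e1 b2 e2 :: bool
  assumes fin: "finite E" and asym: "\<And>u v. (u, v) \<in> E \<Longrightarrow> (v, u) \<notin> E"
    and bl1: "broomless E R b1 e1" and bl2: "broomless (E\<inverse>) R b2 e2"
    and nbh: "\<And>v. dicol E (cnbr E v) h"
begin

lemma converse: "broom_free (E\<inverse>) R h b2 e2 b1 e1"
  using fin asym bl1 bl2 nbh by unfold_locales auto

lemma finite_nbr: "finite (sgn_nbr E b z)"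
  using fin by (simp add: sgn_nbr_def finite_Image)

lemma irrefl: "(v, v) \<notin> E"
  using asym by blast

lemma broom1:
  "(q, z) \<in> E \<Longrightarrow> p \<in> sgn_nbr E b1 q \<Longrightarrow> p \<notin> cnbr E z \<Longrightarrow>
    card (sgn_nbr E e1 z - cnbr E p - cnbr E q) < R"
  using bl1 unfolding broomless_def by blast

lemma broom2:
  "(z, q) \<in> E \<Longrightarrow> p \<in> sgn_nbr E (\<not> b2) q \<Longrightarrow> p \<notin> cnbr E z \<Longrightarrow>
    card (sgn_nbr E (\<not> e2) z - cnbr E p - cnbr E q) < R"
  using bl2 unfolding broomless_def by simp

text \<open>The star of the broom may point either way, which is why \<open>thin\<close> leaves the
  direction open.\<close>

lemma thin_of_sgn:
  assumes "card (sgn_nbr E b z - X - Y) < R" "S \<inter> X = {}" "S \<inter> Y = {}"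
  shows "thin E R z S"
proof -
  have "card (sgn_nbr E b z \<inter> S) \<le> card (sgn_nbr E b z - X - Y)"
    by (rule card_mono) (use assms(2,3) finite_nbr in auto)
  with assms(1) show ?thesis unfolding thin_def sgn_nbr_def by (cases b) auto
qed

lemma thin1:
  "(q, z) \<in> E \<Longrightarrow> p \<in> sgn_nbr E b1 q \<Longrightarrow> p \<notin> cnbr E z \<Longrightarrow>
    S \<inter> cnbr E p = {} \<Longrightarrow> S \<inter> cnbr E q = {} \<Longrightarrow> thin E R z S"
  using thin_of_sgn[OF broom1] by blast

lemma thin2:
  "(z, q) \<in> E \<Longrightarrow> p \<in> sgn_nbr E (\<not> b2) q \<Longrightarrow> p \<notin> cnbr E z \<Longrightarrow>
    S \<inter> cnbr E p = {} \<Longrightarrow> S \<inter> cnbr E q = {} \<Longrightarrow> thin E R z S"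
  using thin_of_sgn[OF broom2] by blast

lemma thin_if_no_nbr:
  assumes "S \<inter> cnbr E z = {}" "0 < R"
  shows "thin E R z S"
proof -
  have "E `` {z} \<inter> S = {}" using assms(1) by (auto simp: cnbr_def)
  then show ?thesis using assms(2) by (simp add: thin_def)
qed

text \<open>A vertex \<open>z\<close> lying on a path \<open>a \<rightarrow> z \<rightarrow> b\<close> can play \<open>v\<^sub>2\<close> in a broom of either kind,
  with \<open>a\<close> or \<open>b\<close> as \<open>v\<^sub>1\<close>, whichever has the right orientation.\<close>

lemma strong_nbr_thin:
  assumes az: "(a, z) \<in> E" and zb: "(z, b) \<in> E" and x: "x \<in> cnbr E z" "x \<noteq> z"
    and xa: "x \<notin> cnbr E a" and xb: "x \<notin> cnbr E b"
    and S: "S \<inter> cnbr E a = {}" "S \<inter> cnbr E b = {}" "S \<inter> cnbr E z = {}"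
  shows "thin E R x S"
proof -
  have ab: "a \<notin> cnbr E x" "b \<notin> cnbr E x" using xa xb cnbr_sym[of x] by auto
  have sgn: "\<exists>p\<in>{a, b}. p \<in> sgn_nbr E s z" for s
    using az zb by (cases s) (auto simp: sgn_nbr_def)
  from x consider "(z, x) \<in> E" | "(x, z) \<in> E" by (auto simp: cnbr_def)
  then show ?thesis
  proof cases
    case 1
    then show ?thesis using sgn[of b1] thin1[OF 1] ab S by blast
  next
    case 2
    then show ?thesis using sgn[of "\<not> b2"] thin2[OF 2] ab S by blast
  qed
qed

text \<open>Since \<open>S\<close> avoids the neighbourhoods of \<open>a\<close> and
  \<open>b\<close>, the part of \<open>S\<close> next to any single \<open>z\<close> in
  \<open>Z\<close> can be peeled by \<open>strong_nbr_thin\<close>.\<close>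

lemma dicol_strong_nbrs:
  assumes S: "finite S" and R: "0 < R"
    and strong: "\<And>z. z \<in> Z \<Longrightarrow> \<exists>a b. (a, z) \<in> E \<and> (z, b) \<in> E
      \<and> S \<inter> cnbr E a = {} \<and> S \<inter> cnbr E b = {}"
    and SZ: "S \<subseteq> (\<Union>z\<in>Z. cnbr E z)"
  shows "dicol E S (2 * h * R)"
proof (rule dicol_if_peelable[OF S fin])
  fix S' assume S': "S' \<subseteq> S" "S' \<noteq> {}"
  then obtain z where z: "z \<in> Z" "cnbr E z \<inter> S' \<noteq> {}" using SZ by blast
  obtain a b where ab: "(a, z) \<in> E" "(z, b) \<in> E" "S \<inter> cnbr E a = {}" "S \<inter> cnbr E b = {}"
    using strong[OF z(1)] by blast
  let ?Q = "cnbr E z \<inter> S'"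
  have "z \<in> cnbr E a" using ab(1) by (simp add: mem_cnbr)
  then have "z \<notin> S" using ab(3) by blast
  have "thin E R x (S' - ?Q)" if "x \<in> ?Q" for x
    by (rule strong_nbr_thin[OF ab(1,2)]) (use that S' ab(3,4) \<open>z \<notin> S\<close> in auto)
  moreover have "dicol E ?Q h" by (rule dicol_mono[OF nbh]) auto
  ultimately show "peelable E R h S'" unfolding peelable_def using z(2) by blast
qed

text \<open>The first candidate for \<open>Q\<close> is the part of \<open>S\<close> next to
  \<open>A\<close>. Its vertices on paths from \<open>A\<close> to \<open>A\<close> may still have
  many neighbours in the rest of \<open>S\<close>, so these neighbours are added as
  \<open>Y\<close>. They are thin by \<open>strong_nbr_thin\<close> and can be coloured by
  \<open>dicol_strong_nbrs\<close>.\<close>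

lemma peelable_core:
  assumes S: "finite S" and R: "0 < R"
    and ne: "S \<inter> (\<Union>a\<in>A. cnbr E a) \<noteq> {}"
    and m: "dicol E (S \<inter> (\<Union>a\<in>A. cnbr E a)) m"
    and cases: "\<And>z. z \<in> S \<inter> (\<Union>a\<in>A. cnbr E a) \<Longrightarrow>
      thin E R z (S - (\<Union>a\<in>A. cnbr E a)) \<or> (\<exists>a\<in>A. \<exists>b\<in>A. (a, z) \<in> E \<and> (z, b) \<in> E)"
  shows "peelable E R (m + 2 * h * R) S"
proof -
  let ?N = "\<Union>a\<in>A. cnbr E a"
  define Z where "Z = {z \<in> S \<inter> ?N. \<exists>a\<in>A. \<exists>b\<in>A. (a, z) \<in> E \<and> (z, b) \<in> E}"
  define Y where "Y = (S - ?N) \<inter> (\<Union>z\<in>Z. cnbr E z)"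
  define Q where "Q = (S \<inter> ?N) \<union> Y"
  have "dicol E Y (2 * h * R)"
  proof (rule dicol_strong_nbrs[of Y Z])
    fix z assume "z \<in> Z"
    then obtain a b where "a \<in> A" "b \<in> A" "(a, z) \<in> E" "(z, b) \<in> E" unfolding Z_def by blast
    then show "\<exists>a b. (a, z) \<in> E \<and> (z, b) \<in> E \<and> Y \<inter> cnbr E a = {} \<and> Y \<inter> cnbr E b = {}"
      unfolding Y_def by blast
  qed (use S R in \<open>auto simp: Y_def\<close>)
  then have "dicol E Q (m + 2 * h * R)" unfolding Q_def using m dicol_Un by blast
  moreover have "thin E R z (S - Q)" if z: "z \<in> Q" for z
  proof (cases "z \<in> Y")
    case True
    then obtain y where y: "y \<in> Z" "z \<in> cnbr E y" "z \<in> S - ?N" unfolding Y_def by blast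
    then obtain a b where ab: "a \<in> A" "b \<in> A" "(a, y) \<in> E" "(y, b) \<in> E" unfolding Z_def by blast
    show ?thesis
      by (rule strong_nbr_thin[OF ab(3,4) y(2)]) (use y ab in \<open>auto simp: Q_def Y_def Z_def\<close>)
  next
    case False
    with z have zN: "z \<in> S \<inter> ?N" by (auto simp: Q_def)
    show ?thesis
    proof (cases "z \<in> Z")
      case True
      then show ?thesis by (intro thin_if_no_nbr R) (auto simp: Q_def Y_def)
    next
      case False
      with cases[OF zN] zN have "thin E R z (S - ?N)" unfolding Z_def by blast
      then show ?thesis by (rule thin_mono) (auto simp: Q_def fin)
    qed
  qed
  ultimately show ?thesis unfolding peelable_def using ne by (intro exI[of _ Q]) (auto simp: Q_def Y_def)
qed

end

section \<open>Closure under short ears\<close>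

text \<open>The ends \<open>c\<close> and \<open>c'\<close> may coincide, so a directed triangle
  through a vertex of \<open>C\<close> counts as an ear. Interior vertices come from
  \<open>S\<close>, while \<open>p\<close> and \<open>x\<close> may lie outside.\<close>

inductive ears :: "'a rel \<Rightarrow> 'a set \<Rightarrow> 'a \<Rightarrow> 'a \<Rightarrow> 'a set \<Rightarrow> bool" for E S p x where
  base: "ears E S p x {p, x}"
| ear1: "ears E S p x C \<Longrightarrow> c \<in> C \<Longrightarrow> c' \<in> C \<Longrightarrow> y \<in> S \<Longrightarrow>
    (c, y) \<in> E \<Longrightarrow> (y, c') \<in> E \<Longrightarrow> ears E S p x (insert y C)"
| ear2: "ears E S p x C \<Longrightarrow> c \<in> C \<Longrightarrow> c' \<in> C \<Longrightarrow> y \<in> S \<Longrightarrow> y' \<in> S \<Longrightarrow>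
    (c, y) \<in> E \<Longrightarrow> (y, y') \<in> E \<Longrightarrow> (y', c') \<in> E \<Longrightarrow> ears E S p x (insert y (insert y' C))"

lemma ears_subset: "ears E S p x C \<Longrightarrow> {p, x} \<subseteq> C \<and> C \<subseteq> insert p (insert x S)"
  by (induction rule: ears.induct) auto

text \<open>Consider the stage at which an in-neighbour of \<open>z\<close> first appears. The
  earliest vertex of the new ear that sends an arc to \<open>z\<close> has a predecessor that does
  not; if no ear is involved yet, the pair is \<open>x\<close> with predecessor
  \<open>p\<close>.\<close>

lemma ears_last_step:
  assumes "ears E S p x C" "(p, x) \<in> E" "(p, z) \<notin> E" "c \<in> C" "(c, z) \<in> E"
  shows "\<exists>d\<in>C. \<exists>d'\<in>C. (d', d) \<in> E \<and> (d, z) \<in> E \<and> (d', z) \<notin> E"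
  using assms
proof (induction arbitrary: c rule: ears.induct)
  case base
  then show ?case by auto
next
  case (ear1 C a a' y)
  show ?case
  proof (cases "\<exists>c\<in>C. (c, z) \<in> E")
    case True
    then show ?thesis using ear1.IH ear1.prems by blast
  next
    case False
    then have "(a, z) \<notin> E" "(y, z) \<in> E" using ear1 by auto
    then show ?thesis using ear1.hyps by blast
  qed
next
  case (ear2 C a a' y y')
  show ?case
  proof (cases "\<exists>c\<in>C. (c, z) \<in> E")
    case True
    then show ?thesis using ear2.IH ear2.prems by blast
  next
    case False
    then have "(a, z) \<notin> E" "(y, z) \<in> E \<or> (y', z) \<in> E" using ear2 by auto
    then show ?thesis using ear2.hyps by blast
  qed
qed

context broom_free
begin

text \<open>If \<open>T\<close> meets the neighbourhood of the earlier set, induction applies.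
  Otherwise only the one or two new vertices touch \<open>T\<close>, so \<open>2 * h\<close> colours
  suffice there, and the older vertices, being nonadjacent to \<open>T\<close>, can serve as
  \<open>v1\<close>.\<close>

lemma ears_peelable:
  assumes "ears E S p x C" and b: "\<not> b1" "\<not> b2" and R: "0 < R"
    and "finite T" and "T \<inter> (\<Union>c\<in>C. cnbr E c) \<noteq> {}" and "T \<inter> (cnbr E p \<union> cnbr E x) = {}"
  shows "peelable E R (2 * h + 2 * h * R) T"
  using assms(1,5-)
proof (induction rule: ears.induct)
  case base
  then show ?case by auto
next
  case (ear1 C a a' y)
  let ?N = "\<lambda>C. \<Union>c\<in>C. cnbr E c"
  show ?case
  proof (cases "T \<inter> ?N C = {}")
    case False
    then show ?thesis using ear1.IH ear1.prems by blast
  next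
    case True
    then have sub: "T \<inter> ?N (insert y C) \<subseteq> cnbr E y" by auto
    have yN: "y \<in> ?N C" using ear1.hyps by (auto simp: mem_cnbr)
    show ?thesis
    proof (rule peelable_core[of T "insert y C"])
      show "dicol E (T \<inter> ?N (insert y C)) (2 * h)"
        using dicol_mono[OF nbh sub] by simp
    next
      fix z assume z: "z \<in> T \<inter> ?N (insert y C)"
      have nC: "c \<notin> cnbr E z" if "c \<in> C" for c using that True z cnbr_sym[of c] by blast
      have "z \<noteq> y" using yN z True by auto
      then consider "(y, z) \<in> E" | "(z, y) \<in> E" using sub z by (auto simp: cnbr_def)
      then have "thin E R z (T - ?N (insert y C))"
      proof cases
        case 1
        show ?thesis
          by (rule thin1[OF 1, of a]) (use b ear1.hyps nC in \<open>auto simp: sgn_nbr_def\<close>)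
      next
        case 2
        show ?thesis
          by (rule thin2[OF 2, of a']) (use b ear1.hyps nC in \<open>auto simp: sgn_nbr_def\<close>)
      qed
      then show "thin E R z (T - ?N (insert y C)) \<or>
        (\<exists>a\<in>insert y C. \<exists>b\<in>insert y C. (a, z) \<in> E \<and> (z, b) \<in> E)" ..
    qed (use ear1.prems R in auto)
  qed
next
  case (ear2 C a a' y y')
  let ?N = "\<lambda>C. \<Union>c\<in>C. cnbr E c"
  let ?A = "insert y (insert y' C)"
  show ?case
  proof (cases "T \<inter> ?N C = {}")
    case False
    then show ?thesis using ear2.IH ear2.prems by blast
  next
    case True
    then have sub: "T \<inter> ?N ?A \<subseteq> cnbr E y \<union> cnbr E y'" by auto
    have yN: "y \<in> ?N C" "y' \<in> ?N C" using ear2.hyps by (auto simp: mem_cnbr)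
    show ?thesis
    proof (rule peelable_core[of T ?A])
      show "dicol E (T \<inter> ?N ?A) (2 * h)"
        using dicol_mono[OF dicol_Un[OF nbh nbh] sub] by simp
    next
      fix z assume z: "z \<in> T \<inter> ?N ?A"
      have nC: "c \<notin> cnbr E z" if "c \<in> C" for c using that True z cnbr_sym[of c] by blast
      have "z \<in> cnbr E y \<union> cnbr E y'" using sub z by blast
      moreover have "z \<noteq> y" "z \<noteq> y'" using yN z True by auto
      \<comment> \<open>In the first two cases \<open>v1\<close> lies in \<open>C\<close>; in the
        third \<open>z\<close> lies on a path between core vertices; in the last two
        \<open>v1\<close> is the other interior vertex of the ear.\<close>
      ultimately consider "(y, z) \<in> E" | "(z, y') \<in> E" | "(y', z) \<in> E" "(z, y) \<in> E"
        | "(y', z) \<in> E" "y \<notin> cnbr E z" | "(z, y) \<in> E" "y' \<notin> cnbr E z"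
        unfolding Un_iff mem_cnbr by blast
      then show "thin E R z (T - ?N ?A) \<or> (\<exists>a\<in>?A. \<exists>b\<in>?A. (a, z) \<in> E \<and> (z, b) \<in> E)"
      proof cases
        case 1
        have "thin E R z (T - ?N ?A)"
          by (rule thin1[OF 1, of a]) (use b ear2.hyps nC in \<open>auto simp: sgn_nbr_def\<close>)
        then show ?thesis ..
      next
        case 2
        have "thin E R z (T - ?N ?A)"
          by (rule thin2[OF 2, of a']) (use b ear2.hyps nC in \<open>auto simp: sgn_nbr_def\<close>)
        then show ?thesis ..
      next
        case 3
        then show ?thesis by blast
      next
        case 4
        have "thin E R z (T - ?N ?A)"
          by (rule thin1[OF 4(1), of y]) (use b ear2.hyps 4 in \<open>auto simp: sgn_nbr_def\<close>)
        then show ?thesis ..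
      next
        case 5
        have "thin E R z (T - ?N ?A)"
          by (rule thin2[OF 5(1), of y']) (use b ear2.hyps 5 in \<open>auto simp: sgn_nbr_def\<close>)
        then show ?thesis ..
      qed
    qed (use ear2.prems R in auto)
  qed
qed

lemma dicol_case_out:
  assumes b: "\<not> b1" "\<not> b2" "e1" and R: "0 < R" and V: "finite V" "E \<subseteq> V \<times> V"
    and strong: "\<And>W. W \<subseteq> V \<Longrightarrow> W \<noteq> {} \<Longrightarrow> W \<noteq> V \<Longrightarrow> \<exists>u v. (u, v) \<in> E \<and> u \<in> W \<and> v \<notin> W"
  shows "dicol E V (h + 2 * (2 * h + 2 * (2 * h + 2 * h * R) * R) * R)"
proof (cases "V = {}")
  case False
  then obtain r where r: "r \<in> V" by blast
  define S where "S = V - insert r (E `` {r})"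
  let ?m = "2 * h + 2 * (2 * h + 2 * h * R) * R"
  let ?N = "\<lambda>C. \<Union>c\<in>C. cnbr E c"
  have "dicol E S (2 * ?m * R)"
  proof (rule dicol_if_peelable[OF _ fin])
    show "finite S" using V by (simp add: S_def)
    fix S' assume S': "S' \<subseteq> S" "S' \<noteq> {}"
    have finS': "finite S'" using \<open>finite S\<close> S'(1) finite_subset by blast
    define O' where "O' = {v \<in> V. insert v (E `` {v}) \<inter> S' = {}}"
    have "r \<in> O'" using r S' by (auto simp: O'_def S_def)
    moreover have "O' \<noteq> V" using S' by (auto simp: O'_def S_def)
    moreover have "O' \<subseteq> V" by (auto simp: O'_def)
    ultimately obtain p x where px: "(p, x) \<in> E" "p \<in> O'" "x \<notin> O'"
      using strong[of O'] by blast
    have pS': "(p, z) \<notin> E" if "z \<in> S'" for z using that px(2) by (auto simp: O'_def)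
    \<comment> \<open>As \<open>p\<close> sends no arc into \<open>S'\<close>, the vertex
      \<open>x\<close> is outside \<open>S'\<close>; not being in \<open>O'\<close>, it must send an
      arc into \<open>S'\<close>. This makes \<open>Q\<close> nonempty.\<close>
    have xS': "E `` {x} \<inter> S' \<noteq> {}" using px V(2) pS' by (auto simp: O'_def)
    have "{C. ears E S' p x C} \<subseteq> Pow (insert p (insert x S'))" using ears_subset[of E S' p x] by auto
    moreover have "finite (Pow (insert p (insert x S')))" using finS' by simp
    ultimately have "finite {C. ears E S' p x C}" by (rule finite_subset)
    moreover have "{C. ears E S' p x C} \<noteq> {}" using ears.base[of E S' p x] by blast
    ultimately have "\<exists>C\<in>{C. ears E S' p x C}. \<forall>D\<in>{C. ears E S' p x C}. C \<subseteq> D \<longrightarrow> C = D"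
      by (rule finite_has_maximal)
    then obtain C where C: "ears E S' p x C" "\<And>D. ears E S' p x D \<Longrightarrow> C \<subseteq> D \<Longrightarrow> C = D"
      by auto
    have no_ear1: "y \<in> C" if "c \<in> C" "c' \<in> C" "y \<in> S'" "(c, y) \<in> E" "(y, c') \<in> E" for c c' y
      using C(2)[OF ears.ear1[OF C(1) that]] by blast
    have no_ear2: "y \<in> C" if "c \<in> C" "c' \<in> C" "y \<in> S'" "y' \<in> S'" "(c, y) \<in> E" "(y, y') \<in> E" "(y', c') \<in> E"
      for c c' y y'
      using C(2)[OF ears.ear2[OF C(1) that]] by blast
    define Q where "Q = S' \<inter> (C \<union> E `` C)"
    have "x \<in> C" using ears_subset[OF C(1)] by blast
    then have "Q \<noteq> {}" using xS' by (auto simp: Q_def)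
    moreover have "thin E R z (S' - Q)" if z: "z \<in> Q" for z
    proof (cases "z \<in> C")
      case True
      then have "E `` {z} \<inter> (S' - Q) = {}" by (auto simp: Q_def)
      then show ?thesis using R by (simp add: thin_def)
    next
      case False
      with z obtain c where "c \<in> C" "(c, z) \<in> E" "z \<in> S'" by (auto simp: Q_def)
      with ears_last_step[OF C(1) px(1) pS'[of z]] obtain d d'
        where d: "d \<in> C" "d' \<in> C" "(d', d) \<in> E" "(d, z) \<in> E" "(d', z) \<notin> E" by blast
      \<comment> \<open>An arc from \<open>z\<close> to \<open>d'\<close> would make
        \<open>z\<close> the interior of an ear, against maximality; so \<open>d'\<close>,
        \<open>d\<close>, \<open>z\<close> start the first broom.\<close>
      have "(z, d') \<notin> E" using no_ear1[OF d(1,2) \<open>z \<in> S'\<close> d(4)] False by blast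
      then have "d' \<notin> cnbr E z" using d False by (auto simp: mem_cnbr)
      then have "card (E `` {z} - cnbr E d' - cnbr E d) < R"
        using broom1[OF d(4), of d'] b d(3) by (auto simp: sgn_nbr_def)
      moreover have "card (E `` {z} \<inter> (S' - Q)) \<le> card (E `` {z} - cnbr E d' - cnbr E d)"
      proof (rule card_mono)
        \<comment> \<open>A vertex outside \<open>Q\<close> receives no arc from \<open>C\<close>,
          and an arc from it into \<open>C\<close> would close an ear with interior
          \<open>z\<close>, \<open>w\<close>.\<close>
        have "w \<notin> cnbr E c" if "w \<in> E `` {z} \<inter> (S' - Q)" "c \<in> C" for w c
          using that no_ear2[OF d(1), of c z w] False \<open>z \<in> S'\<close> d(4) by (auto simp: mem_cnbr Q_def)
        then show "E `` {z} \<inter> (S' - Q) \<subseteq> E `` {z} - cnbr E d' - cnbr E d" using d(1,2) by blast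
      qed (use fin in \<open>simp add: finite_Image\<close>)
      ultimately show ?thesis by (simp add: thin_def)
    qed
    moreover have "dicol E Q ?m"
    proof -
      \<comment> \<open>The neighbourhoods of \<open>p\<close> and \<open>x\<close> are coloured
        separately because \<open>ears_peelable\<close> needs sets that avoid them.\<close>
      let ?T = "S' \<inter> ?N C - (cnbr E p \<union> cnbr E x)"
      have "dicol E ?T (2 * (2 * h + 2 * h * R) * R)"
      proof (rule dicol_if_peelable[OF _ fin])
        fix T assume T: "T \<subseteq> ?T" "T \<noteq> {}"
        show "peelable E R (2 * h + 2 * h * R) T"
          by (rule ears_peelable[OF C(1) b(1,2) R])
            (use T finS' finite_subset[of T S'] in auto)
      qed (use finS' in auto)
      then have "dicol E ((cnbr E p \<union> cnbr E x) \<union> ?T) ((h + h) + 2 * (2 * h + 2 * h * R) * R)"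
        by (intro dicol_Un nbh)
      moreover have "Q \<subseteq> (cnbr E p \<union> cnbr E x) \<union> ?T" by (auto simp: Q_def cnbr_def)
      ultimately show ?thesis by (rule dicol_mono) simp
    qed
    ultimately show "peelable E R ?m S'"
      unfolding peelable_def by (intro exI[of _ Q]) (auto simp: Q_def)
  qed
  then have "dicol E (cnbr E r \<union> S) (h + 2 * ?m * R)" by (intro dicol_Un nbh)
  moreover have "V \<subseteq> cnbr E r \<union> S" by (auto simp: S_def cnbr_def)
  ultimately show ?thesis by (rule dicol_mono) simp
qed simp

end

section \<open>Saturated bicliques\<close>

definition stable_set :: "'a rel \<Rightarrow> 'a set \<Rightarrow> bool" where
  "stable_set E I \<longleftrightarrow> (\<forall>u\<in>I. \<forall>v\<in>I. (u, v) \<notin> E)"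

lemma stable_set_converse [simp]: "stable_set (E\<inverse>) I \<longleftrightarrow> stable_set E I"
  by (auto simp: stable_set_def)

lemma stable_set_cnbr: "stable_set E I \<Longrightarrow> u \<in> I \<Longrightarrow> v \<in> I \<Longrightarrow> u \<noteq> v \<Longrightarrow> u \<notin> cnbr E v"
  by (auto simp: stable_set_def mem_cnbr)

text \<open>Only vertices obstructing the peeling are added, and only next to the side
  \<open>X\<close>; the latter restriction keeps the growth bounded.\<close>

inductive saturation :: "'a rel \<Rightarrow> nat \<Rightarrow> 'a set \<Rightarrow> 'a set \<Rightarrow> 'a set \<Rightarrow> 'a set \<Rightarrow> bool"
  for E R S X Y where
  base: "saturation E R S X Y (X \<union> Y)"
| step: "saturation E R S X Y Z \<Longrightarrow> z \<in> S \<Longrightarrow> x \<in> X \<Longrightarrow> x \<in> cnbr E z \<Longrightarrow>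
    \<not> thin E R z (S - (\<Union>y\<in>Z. cnbr E y)) \<Longrightarrow> saturation E R S X Y (insert z Z)"

lemma saturation_subset:
  "saturation E R S X Y Z \<Longrightarrow> X \<union> Y \<subseteq> Z \<and> Z \<subseteq> X \<union> Y \<union> (S \<inter> (\<Union>x\<in>X. cnbr E x))"
  by (induction rule: saturation.induct) (auto simp: mem_cnbr)

text \<open>The remaining sign pattern: the first broom has a directed path \<open>v1\<close>,
  \<open>v2\<close>, \<open>v3\<close> and a star pointing into \<open>v3\<close>, and the second
  has the reversed shape. The function \<open>ram\<close> is a Ramsey bound with the clique
  alternative already excluded.\<close>

locale ramsey_broom_free = broom_free +
  fixes ram :: "nat \<Rightarrow> nat"
  assumes ram: "\<And>n S. finite S \<Longrightarrow> ram n \<le> card S \<Longrightarrow> \<exists>I\<subseteq>S. card I = n \<and> stable_set E I"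
    and R: "0 < R" and signs: "\<not> b1" "\<not> e1" "\<not> b2" "\<not> e2"
begin

lemma ramsey_converse: "ramsey_broom_free (E\<inverse>) R h b2 e2 b1 e1 ram"
  using ram R signs converse
  by (simp add: ramsey_broom_free_def ramsey_broom_free_axioms_def)

lemma broom_in:
  assumes "(p, q) \<in> E" "(q, z) \<in> E" "p \<notin> cnbr E z"
  shows "card (E\<inverse> `` {z} - cnbr E p - cnbr E q) < R"
  using broom1[OF assms(2) _ assms(3)] assms(1) signs by (simp add: sgn_nbr_def)

text \<open>Take an out-neighbour \<open>w\<close> of \<open>z\<close> away from \<open>X\<close>.
  The second broom on \<open>w\<close>, \<open>z\<close>, \<open>x\<close> leaves \<open>x\<close>
  fewer than \<open>R\<close> out-neighbours nonadjacent to \<open>w\<close> and \<open>z\<close>.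
  An in-neighbour of \<open>x\<close> in \<open>X\<close> nonadjacent to \<open>z\<close> would make
  \<open>z\<close> thin by the first broom.\<close>

lemma not_thin_nbrs:
  assumes bad: "\<not> thin E R z (S - (\<Union>y\<in>X. cnbr E y))" and x: "x \<in> X" "(x, z) \<in> E"
  shows "card ((X \<inter> cnbr E x) - insert x (cnbr E z)) < R"
proof -
  let ?N = "\<Union>y\<in>X. cnbr E y"
  have "R \<le> card (E `` {z} \<inter> (S - ?N))" using bad by (simp add: thin_def)
  then have "E `` {z} \<inter> (S - ?N) \<noteq> {}" using R by auto
  then obtain w where w: "(z, w) \<in> E" "w \<notin> ?N" by blast
  have xw: "u \<notin> cnbr E w" if "u \<in> X" for u using that w(2) cnbr_sym[of u] by blast
  have out: "card (E `` {x} - cnbr E w - cnbr E z) < R"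
    using broom2[OF x(2), of w] xw[OF x(1)] w(1) signs cnbr_sym[of w]
    by (simp add: sgn_nbr_def)
  have "u \<in> E `` {x} - cnbr E w - cnbr E z"
    if u: "u \<in> (X \<inter> cnbr E x) - insert x (cnbr E z)" for u
  proof -
    have "(u, x) \<notin> E"
    proof
      assume ux: "(u, x) \<in> E"
      have "thin E R z (S - ?N)"
        by (rule thin1[OF x(2), of u]) (use u ux x(1) signs in \<open>auto simp: sgn_nbr_def\<close>)
      with bad show False ..
    qed
    with u xw show ?thesis by (auto simp: mem_cnbr)
  qed
  then have "card ((X \<inter> cnbr E x) - insert x (cnbr E z)) \<le> card (E `` {x} - cnbr E w - cnbr E z)"
    by (intro card_mono) (use fin in \<open>auto simp: finite_Image\<close>)
  with out show ?thesis by simp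
qed

lemma not_thin_cnbrs:
  assumes bad: "\<not> thin E R z (S - (\<Union>y\<in>X. cnbr E y))" and x: "x \<in> X" "x \<in> cnbr E z"
  shows "card ((X \<inter> cnbr E x) - insert x (cnbr E z)) < R"
proof -
  have "x \<noteq> z"
  proof
    assume "x = z"
    with x have "thin E R z (S - (\<Union>y\<in>X. cnbr E y))" by (intro thin_if_no_nbr R) auto
    with bad show False ..
  qed
  with x(2) consider "(x, z) \<in> E" | "(z, x) \<in> E" by (auto simp: mem_cnbr)
  then show ?thesis
  proof cases
    case 1
    then show ?thesis using not_thin_nbrs[OF bad x(1)] by simp
  next
    case 2
    interpret rev: ramsey_broom_free "E\<inverse>" R h b2 e2 b1 e1 ram by (rule ramsey_converse)
    show ?thesis using rev.not_thin_nbrs[of z S X x] bad x(1) 2 by simp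
  qed
qed

text \<open>A new \<open>z\<close> next to \<open>x\<close> is adjacent to all but fewer than
  \<open>R\<close> of the neighbours of \<open>x\<close> in \<open>Z\<close>, hence to some
  \<open>u\<close> in \<open>Y\<close>. The same argument at \<open>u\<close>, which is adjacent to
  all of \<open>X\<close>, gives the bound.\<close>

lemma saturation_nbrs:
  assumes "saturation E R S X Y Z" and fXY: "finite X" "finite Y"
    and XY: "\<And>x y. x \<in> X \<Longrightarrow> y \<in> Y \<Longrightarrow> x \<noteq> y \<and> y \<in> cnbr E x"
    and card: "card X = 2 * R" "card Y = 2 * R"
    and y: "y \<in> Z - X"
  shows "R \<le> card (X \<inter> cnbr E y)"
  using assms(1) y
proof (induction arbitrary: y rule: saturation.induct)
  case base
  then have "X \<inter> cnbr E y = X" using XY cnbr_sym[of y E] by blast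
  then show ?case using card by simp
next
  case (step Z z x)
  have sub: "X \<union> Y \<subseteq> Z" using saturation_subset[OF step.hyps(1)] by blast
  show ?case
  proof (cases "y \<in> Z")
    case True
    then show ?thesis using step by blast
  next
    case False
    then have y: "y = z" "z \<notin> Z" using step.prems by auto
    have "\<not> Y \<subseteq> Z \<inter> cnbr E x - insert x (cnbr E z)"
    proof
      assume *: "Y \<subseteq> Z \<inter> cnbr E x - insert x (cnbr E z)"
      have "finite (Z \<inter> cnbr E x - insert x (cnbr E z))"
        using fin by (simp add: cnbr_def finite_Image)
      from card_mono[OF this *] show False
        using not_thin_cnbrs[OF step.hyps(5), of x] step.hyps(3,4) sub card R by auto
    qed
    then obtain u where u: "u \<in> Y" "u \<in> cnbr E z"
      using sub XY[OF step.hyps(3)] by blast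
    have "u \<in> Z" using u sub by blast
    have "X - cnbr E z \<subseteq> Z \<inter> cnbr E u - insert u (cnbr E z)"
      using sub XY[OF _ u(1)] cnbr_sym[of u E] by blast
    then have "card (X - cnbr E z) \<le> card (Z \<inter> cnbr E u - insert u (cnbr E z))"
      by (intro card_mono) (use fin in \<open>auto simp: cnbr_def finite_Image\<close>)
    also have "\<dots> < R" using not_thin_cnbrs[OF step.hyps(5) \<open>u \<in> Z\<close> u(2)] .
    finally have "card (X - cnbr E z) < R" .
    moreover have "card X = card (X - cnbr E z) + card (X \<inter> cnbr E z)"
      using fXY card_Int_Diff[of X "cnbr E z"] by simp
    ultimately show ?thesis using card y by simp
  qed
qed

text \<open>A newly added \<open>z\<close> is adjacent to all but fewer than \<open>R\<close> of the current neighbours of \<open>x\<close>, so it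
  cannot enlarge a big stable set of earlier additions.\<close>

lemma saturation_stable:
  assumes "saturation E R S X Y Z" "x \<in> X" "I \<subseteq> (Z - (X \<union> Y)) \<inter> cnbr E x" "stable_set E I"
  shows "card I \<le> R"
  using assms(1,3,4)
proof (induction arbitrary: I rule: saturation.induct)
  case base
  then have "I = {}" by blast
  then show ?case by simp
next
  case (step Z z x')
  have sub: "X \<union> Y \<subseteq> Z" using saturation_subset[OF step.hyps(1)] by blast
  show ?case
  proof (cases "z \<in> I \<and> z \<notin> Z")
    case False
    then have "I \<subseteq> (Z - (X \<union> Y)) \<inter> cnbr E x" using step.prems by blast
    then show ?thesis using step by blast
  next
    case True
    have "I - {z} \<subseteq> Z \<inter> cnbr E x - insert x (cnbr E z)"
      using step.prems True assms(2) stable_set_cnbr[OF step.prems(2), of _ z] by blast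
    then have "card (I - {z}) \<le> card (Z \<inter> cnbr E x - insert x (cnbr E z))"
      by (intro card_mono) (use fin in \<open>auto simp: cnbr_def finite_Image\<close>)
    also have "\<dots> < R"
      using not_thin_cnbrs[OF step.hyps(5), of x] assms(2) sub True step.prems cnbr_sym[of x E z]
      by blast
    finally have "card (I - {z}) < R" .
    then show ?thesis by (simp add: card_Diff_singleton_if split: if_splits)
  qed
qed

text \<open>No vertex of \<open>X\<close> sees a stable set of \<open>R + 1\<close> additions, so by
  Ramsey each of the \<open>2 * R\<close> vertices of \<open>X\<close> accounts for at most
  \<open>ram (R + 1)\<close> of them.\<close>

lemma saturation_card:
  assumes sat: "saturation E R S X Y Z" and S: "finite S" "X \<subseteq> S" "Y \<subseteq> S"
    and card: "card X = 2 * R" "card Y = 2 * R"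
  shows "card Z \<le> 4 * R + 2 * R * ram (R + 1)"
proof -
  have ZS: "Z \<subseteq> S" "X \<union> Y \<subseteq> Z" "Z \<subseteq> X \<union> Y \<union> (\<Union>x\<in>X. (Z - (X \<union> Y)) \<inter> cnbr E x)"
    using saturation_subset[OF sat] S by auto
  then have finZ: "finite Z" "finite X" "finite Y" using S finite_subset by blast+
  have "card ((Z - (X \<union> Y)) \<inter> cnbr E x) \<le> ram (R + 1)" if "x \<in> X" for x
  proof (rule ccontr)
    assume "\<not> ?thesis"
    then obtain I where I: "I \<subseteq> (Z - (X \<union> Y)) \<inter> cnbr E x" "card I = R + 1" "stable_set E I"
      using ram[of "(Z - (X \<union> Y)) \<inter> cnbr E x" "R + 1"] finZ by auto
    with saturation_stable[OF sat that I(1,3)] show False by simp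
  qed
  then have "card (\<Union>x\<in>X. (Z - (X \<union> Y)) \<inter> cnbr E x) \<le> card X * ram (R + 1)"
    using card_UN_le[OF finZ(2), of "\<lambda>x. (Z - (X \<union> Y)) \<inter> cnbr E x"]
      sum_bounded_above[of X "\<lambda>x. card ((Z - (X \<union> Y)) \<inter> cnbr E x)" "ram (R + 1)"]
    by fastforce
  moreover have "card (X \<union> Y) \<le> 4 * R" using card_Un_le[of X Y] card by simp
  moreover have "card Z \<le> card (X \<union> Y \<union> (\<Union>x\<in>X. (Z - (X \<union> Y)) \<inter> cnbr E x))"
    using ZS finZ by (intro card_mono) auto
  moreover have "\<dots> \<le> card (X \<union> Y) + card (\<Union>x\<in>X. (Z - (X \<union> Y)) \<inter> cnbr E x)"
    by (rule card_Un_le)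
  ultimately show ?thesis unfolding card by linarith
qed

text \<open>Let \<open>Z\<close> be a maximal saturation. A vertex next to \<open>Z\<close> that is
  not thin has no neighbour in \<open>X\<close>, so it has a neighbour \<open>y\<close> in
  \<open>Z - X\<close>. But \<open>y\<close> has at least \<open>R\<close> neighbours in
  \<open>X\<close>, contrary to \<open>not_thin_cnbrs\<close>.\<close>

lemma peelable_biclique:
  assumes S: "finite S" and XS: "X \<subseteq> S" "Y \<subseteq> S"
    and XY: "\<And>x y. x \<in> X \<Longrightarrow> y \<in> Y \<Longrightarrow> x \<noteq> y \<and> y \<in> cnbr E x"
    and card: "card X = 2 * R" "card Y = 2 * R"
  shows "peelable E R ((4 * R + 2 * R * ram (R + 1)) * h) S"
proof -
  have fXY: "finite X" "finite Y" using XS S finite_subset by blast+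
  have "{Z. saturation E R S X Y Z} \<subseteq> Pow S"
    using saturation_subset[of E R S X Y] XS by blast
  then have "finite {Z. saturation E R S X Y Z}" by (rule finite_subset) (simp add: S)
  moreover have "{Z. saturation E R S X Y Z} \<noteq> {}" using saturation.base[of E R S X Y] by blast
  ultimately have "\<exists>Z\<in>{Z. saturation E R S X Y Z}. \<forall>D\<in>{Z. saturation E R S X Y Z}. Z \<subseteq> D \<longrightarrow> Z = D"
    by (rule finite_has_maximal)
  then obtain Z where Z: "saturation E R S X Y Z"
      "\<And>D. saturation E R S X Y D \<Longrightarrow> Z \<subseteq> D \<Longrightarrow> Z = D"
    by auto
  have sub: "X \<union> Y \<subseteq> Z" "Z \<subseteq> S" using saturation_subset[OF Z(1)] XS by auto
  let ?N = "\<Union>y\<in>Z. cnbr E y"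
  have thin: "thin E R z (S - ?N)" if z: "z \<in> S \<inter> ?N" for z
  proof (rule ccontr)
    assume bad: "\<not> ?thesis"
    have zZ: "z \<notin> Z"
    proof
      assume "z \<in> Z"
      then have "thin E R z (S - ?N)" by (intro thin_if_no_nbr R) auto
      with bad show False ..
    qed
    have noX: "x \<notin> cnbr E z" if "x \<in> X" for x
    proof
      assume "x \<in> cnbr E z"
      from saturation.step[OF Z(1) _ that this bad] z have "saturation E R S X Y (insert z Z)" by blast
      from Z(2)[OF this] zZ show False by blast
    qed
    obtain y where y: "y \<in> Z" "y \<in> cnbr E z" using z cnbr_sym[of z] by blast
    then have "y \<in> Z - X" using noX by blast
    then have "R \<le> card (X \<inter> cnbr E y)"
      using saturation_nbrs[OF Z(1) fXY _ card] XY by blast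
    also have "\<dots> \<le> card (Z \<inter> cnbr E y - insert y (cnbr E z))"
    proof (rule card_mono)
      show "X \<inter> cnbr E y \<subseteq> Z \<inter> cnbr E y - insert y (cnbr E z)"
        using sub noX \<open>y \<in> Z - X\<close> by blast
    qed (use fin in \<open>auto simp: cnbr_def finite_Image\<close>)
    also have "\<dots> < R" by (rule not_thin_cnbrs[OF bad y])
    finally show False by simp
  qed
  have "finite Z" using sub S finite_subset by blast
  then have "dicol E ?N (card Z * h)" by (intro dicol_UN nbh)
  moreover have "card Z * h \<le> (4 * R + 2 * R * ram (R + 1)) * h"
    using saturation_card[OF Z(1) S XS card] by (rule mult_right_mono) simp
  ultimately have "dicol E (S \<inter> ?N) ((4 * R + 2 * R * ram (R + 1)) * h)"
    by (rule dicol_mono[OF _ Int_lower2])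
  moreover have "S \<inter> ?N \<noteq> {}"
  proof -
    have "X \<noteq> {}" using card R by auto
    then obtain x where "x \<in> X" by blast
    then have "x \<in> S \<inter> ?N" using sub XS by (auto simp: cnbr_def)
    then show ?thesis by blast
  qed
  moreover have "S - S \<inter> ?N = S - ?N" by blast
  ultimately show ?thesis unfolding peelable_def using thin by (metis Int_lower1)
qed

end

section \<open>Colouring without a large complete bipartite subgraph\<close>

definition biclique :: "'a rel \<Rightarrow> nat \<Rightarrow> 'a set \<Rightarrow> bool" where
  "biclique E m S \<longleftrightarrow> (\<exists>X\<subseteq>S. \<exists>Y\<subseteq>S. card X = m \<and> card Y = m \<and>
    (\<forall>x\<in>X. \<forall>y\<in>Y. x \<noteq> y \<and> y \<in> cnbr E x))"

lemma biclique_converse [simp]: "biclique (E\<inverse>) m S = biclique E m S"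
  by (simp add: biclique_def)

context ramsey_broom_free
begin

text \<open>From many exceptions pick a stable set \<open>I\<close>, some \<open>b\<close> in it and
  \<open>m\<close> in-neighbours \<open>a\<close> of \<open>b\<close> nonadjacent to
  \<open>c\<close>. The broom on \<open>a\<close>, \<open>b\<close>, \<open>c\<close> shows that
  each \<open>a\<close> misses fewer than \<open>R\<close> of the other vertices of
  \<open>I\<close>, so enough of them remain for a biclique.\<close>

lemma card_in_exceptions:
  assumes S: "finite S" and no: "\<not> biclique E m S"
  shows "card {b \<in> S. (b, c) \<in> E \<and> m \<le> card (E\<inverse> `` {b} \<inter> S - cnbr E c)} < ram (1 + m * R + m)"
    (is "card ?B < _")
proof (rule ccontr)
  assume "\<not> ?thesis"
  \<comment> \<open>The size accounts for \<open>b\<close>, at most \<open>m * R\<close> vertices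
    missed by some member of \<open>A\<close>, and \<open>m\<close> vertices for the second
    side.\<close>
  then obtain I where I: "I \<subseteq> ?B" "card I = 1 + m * R + m" "stable_set E I"
    using ram[of ?B "1 + m * R + m"] S by auto
  have finI: "finite I" using I(1) S finite_subset[of I S] by blast
  have "I \<noteq> {}" using I(2) by auto
  then obtain b where b: "b \<in> I" by blast
  then obtain A where A: "A \<subseteq> E\<inverse> `` {b} \<inter> S - cnbr E c" "card A = m"
    using I(1) obtain_subset_with_card_n[of m "E\<inverse> `` {b} \<inter> S - cnbr E c"] by blast
  have finA: "finite A" using A(1) S finite_subset[of A S] by blast
  have "card (I - {b} - cnbr E a) \<le> R" if a: "a \<in> A" for a
  proof -
    have bc: "(b, c) \<in> E" using b I(1) by blast
    have "I - {b} - cnbr E a \<subseteq> E\<inverse> `` {c} - cnbr E a - cnbr E b"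
      using I(1) b stable_set_cnbr[OF I(3) _ b] by blast
    then have "card (I - {b} - cnbr E a) \<le> card (E\<inverse> `` {c} - cnbr E a - cnbr E b)"
      by (intro card_mono) (use fin in \<open>auto simp: finite_Image\<close>)
    also have "\<dots> < R" using broom_in[of a b c] a A(1) bc by blast
    finally show ?thesis by simp
  qed
  then have "card (\<Union>a\<in>A. I - {b} - cnbr E a) \<le> m * R"
    using card_UN_le[OF finA, of "\<lambda>a. I - {b} - cnbr E a"]
      sum_bounded_above[of A "\<lambda>a. card (I - {b} - cnbr E a)" R] A(2)
    by fastforce
  moreover have "card (I - {b}) = m * R + m" using I(2) b finI by simp
  moreover have "card (I - {b}) - card (\<Union>a\<in>A. I - {b} - cnbr E a)
      \<le> card (I - {b} - (\<Union>a\<in>A. I - {b} - cnbr E a))"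
    using finA finI by (intro diff_card_le_card_Diff) simp
  ultimately have "m \<le> card (I - {b} - (\<Union>a\<in>A. I - {b} - cnbr E a))" by linarith
  then obtain Y where Y: "Y \<subseteq> I - {b} - (\<Union>a\<in>A. I - {b} - cnbr E a)" "card Y = m"
    by (rule obtain_subset_with_card_n)
  have "x \<noteq> y \<and> y \<in> cnbr E x" if "x \<in> A" "y \<in> Y" for x y
  proof -
    have "y \<in> cnbr E c" using that(2) Y(1) I(1) by (auto simp: mem_cnbr)
    moreover have "x \<notin> cnbr E c" using that(1) A(1) by blast
    ultimately show ?thesis using that Y(1) by blast
  qed
  moreover have "A \<subseteq> S" "Y \<subseteq> S" using A(1) Y(1) I(1) by auto
  ultimately have "biclique E m S" unfolding biclique_def using A(2) Y(2) by blast
  with no show False ..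
qed

text \<open>The relation \<open>exc\<close> has small out-degree, so few colours make it acyclic on
  each class. A sink \<open>c\<close> of \<open>exc\<close> in the current part of a class has no
  exceptional neighbours there, so its neighbourhood can be peeled, with \<open>m\<close> in the
  role of \<open>R\<close>.\<close>

lemma dicol_no_biclique:
  assumes S: "finite S" and no: "\<not> biclique E m S"
  shows "dicol E S (2 * (2 * ram (1 + m * R + m)) * (2 * h * m))"
proof -
  \<comment> \<open>Pairs \<open>(c, b)\<close> for which the neighbour \<open>b\<close> of \<open>c\<close> may fail to be thin outside \<open>cnbr E c\<close>.\<close>
  define exc where "exc = {(c, b). c \<in> S \<and> b \<in> S \<and>
    ((b, c) \<in> E \<and> m \<le> card (E\<inverse> `` {b} \<inter> S - cnbr E c) \<or>
     (c, b) \<in> E \<and> m \<le> card (E `` {b} \<inter> S - cnbr E c))}"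
  let ?M = "2 * ram (1 + m * R + m)"
  have "exc \<subseteq> S \<times> S" by (auto simp: exc_def)
  then have fin_exc: "finite exc" using S finite_subset by blast
  have exc_deg: "card (exc `` {c}) < ?M" for c
  proof -
    interpret rev: ramsey_broom_free "E\<inverse>" R h b2 e2 b1 e1 ram by (rule ramsey_converse)
    let ?B = "{b \<in> S. (b, c) \<in> E \<and> m \<le> card (E\<inverse> `` {b} \<inter> S - cnbr E c)}"
    let ?C = "{b \<in> S. (c, b) \<in> E \<and> m \<le> card (E `` {b} \<inter> S - cnbr E c)}"
    have "card (exc `` {c}) \<le> card (?B \<union> ?C)"
      by (rule card_mono) (use S in \<open>auto simp: exc_def\<close>)
    also have "\<dots> \<le> card ?B + card ?C" by (rule card_Un_le)
    also have "\<dots> < ?M"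
      using card_in_exceptions[OF S no, of c] rev.card_in_exceptions[OF S, of m c] no by simp
    finally show ?thesis .
  qed
  have "dicol exc S (2 * 1 * ?M)"
  proof (rule dicol_if_peelable[OF S fin_exc])
    fix S' :: "'a set" assume "S' \<subseteq> S" "S' \<noteq> {}"
    then obtain z where z: "z \<in> S'" by blast
    have "card (exc `` {z} \<inter> (S' - {z})) \<le> card (exc `` {z})"
      by (rule card_mono) (use fin_exc in \<open>auto simp: finite_Image\<close>)
    then have "thin exc ?M z (S' - {z})" using exc_deg[of z] by (simp add: thin_def)
    moreover have "dicol exc {z} 1"
      by (rule dicol_singleton) (auto simp: irrefl_def exc_def irrefl)
    ultimately show "peelable exc ?M 1 S'"
      unfolding peelable_def using z by (intro exI[of _ "{z}"]) auto
  qed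
  then obtain f where f: "\<forall>v\<in>S. f v < 2 * ?M"
      "acyclic {(u, v) \<in> exc. u \<in> S \<and> v \<in> S \<and> f u = f v}"
    unfolding dicol_def by auto
  have "dicol E {v \<in> S. f v = i} (2 * h * m)" for i
  proof (rule dicol_if_peelable[OF _ fin])
    fix T assume T: "T \<subseteq> {v \<in> S. f v = i}" "T \<noteq> {}"
    let ?r = "{(u, v) \<in> exc. u \<in> S \<and> v \<in> S \<and> f u = f v}"
    have "finite ?r" by (rule finite_subset[OF _ fin_exc]) auto
    then have "wf (?r\<inverse>)" using f(2) by (rule finite_acyclic_wf_converse)
    moreover obtain c0 where "c0 \<in> T" using T(2) by blast
    ultimately obtain c where c: "c \<in> T" "\<And>y. (y, c) \<in> ?r\<inverse> \<Longrightarrow> y \<notin> T"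
      by (rule wfE_min) (rule that)
    let ?Q = "cnbr E c \<inter> T"
    have cT: "c \<in> S" "f c = i" using c(1) T(1) by auto
    have less: "card (F `` {b} \<inter> (T - ?Q)) \<le> card (F `` {b} \<inter> S - cnbr E c)" if "finite F"
      for F :: "'a rel" and b
      by (rule card_mono) (use that T(1) in \<open>auto simp: finite_Image\<close>)
    have "thin E m b (T - ?Q)" if b: "b \<in> ?Q" "b \<noteq> c" for b
    proof -
      have bS: "b \<in> S" "f b = i" "b \<in> T" using b T(1) by auto
      then have no_exc: "(c, b) \<notin> exc" using c(2)[of b] cT by auto
      consider "(b, c) \<in> E" | "(c, b) \<in> E" using b by (auto simp: mem_cnbr)
      then show ?thesis
      proof cases
        case 1
        then have "card (E\<inverse> `` {b} \<inter> S - cnbr E c) < m"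
          using no_exc bS cT by (auto simp: exc_def)
        then show ?thesis using less[of "E\<inverse>" b] fin by (simp add: thin_def)
      next
        case 2
        then have "card (E `` {b} \<inter> S - cnbr E c) < m"
          using no_exc bS cT by (auto simp: exc_def)
        then show ?thesis using less[of E b] fin by (simp add: thin_def)
      qed
    qed
    moreover have "thin E m c (T - ?Q)"
    proof -
      \<comment> \<open>Empty sides would form a biclique of size 0. As \<open>m\<close> is
        positive, \<open>c\<close> is thin because it has no neighbours outside
        \<open>?Q\<close>.\<close>
      have "m \<noteq> 0"
      proof
        assume "m = 0"
        then have "biclique E m S"
          unfolding biclique_def by (intro exI[of _ "{}"]) auto
        with no show False ..
      qed
      moreover have "E `` {c} \<inter> (T - ?Q) = {}" by (auto simp: cnbr_def)
      ultimately show ?thesis by (simp add: thin_def)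
    qed
    moreover have "dicol E ?Q h" by (rule dicol_mono[OF nbh]) auto
    moreover have "c \<in> ?Q" using c(1) by (simp add: cnbr_def)
    ultimately show "peelable E m h T"
      unfolding peelable_def by (intro exI[of _ ?Q]) blast
  qed (use S in auto)
  then have "dicol E (\<Union>i\<in>{..<2 * ?M}. {v \<in> S. f v = i}) (card {..<2 * ?M} * (2 * h * m))"
    by (intro dicol_UN) auto
  moreover have "S \<subseteq> (\<Union>i\<in>{..<2 * ?M}. {v \<in> S. f v = i})" using f(1) by auto
  ultimately show ?thesis by (rule dicol_mono) simp
qed

lemma dicol_case_in:
  assumes "finite V"
  shows "dicol E V (2 * ((4 * R + 2 * R * ram (R + 1)) * h
    + 2 * (2 * ram (1 + 2 * R * R + 2 * R)) * (2 * h * (2 * R))) * R)"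
proof (rule dicol_if_peelable[OF assms fin])
  fix S assume "S \<subseteq> V" "S \<noteq> {}"
  then have S: "finite S" using assms finite_subset by blast
  show "peelable E R ((4 * R + 2 * R * ram (R + 1)) * h
    + 2 * (2 * ram (1 + 2 * R * R + 2 * R)) * (2 * h * (2 * R))) S"
  proof (cases "biclique E (2 * R) S")
    case True
    then obtain X Y where "X \<subseteq> S" "Y \<subseteq> S" "card X = 2 * R" "card Y = 2 * R"
      "\<forall>x\<in>X. \<forall>y\<in>Y. x \<noteq> y \<and> y \<in> cnbr E x"
      unfolding biclique_def by blast
    then have "peelable E R ((4 * R + 2 * R * ram (R + 1)) * h) S"
      by (intro peelable_biclique[OF S, of X Y]) auto
    then show ?thesis by (rule peelable_mono) simp
  next
    case False
    \<comment> \<open>Here all of \<open>S\<close> is peeled at once, so thinness towards the empty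
      rest is trivial.\<close>
    from dicol_no_biclique[OF S this]
    have "peelable E R (2 * (2 * ram (1 + 2 * R * R + 2 * R)) * (2 * h * (2 * R))) S"
      unfolding peelable_def using \<open>S \<noteq> {}\<close> R by (intro exI[of _ S]) (simp add: thin_def)
    then show ?thesis by (rule peelable_mono) simp
  qed
qed

end

section \<open>Shortest return walks\<close>

text \<open>A shortest path from \<open>x\<close> to \<open>W\<close> is prefixed by
  \<open>p\<close>. A detour through \<open>z\<close> bypassing more than two steps would shorten
  it; minimality is measured from \<open>x\<close>, hence the restriction
  \<open>1 \<le> i\<close>.\<close>

lemma shortest_return_walk:
  assumes px: "(p, x) \<in> E" "p \<in> W" and xw: "(x, w) \<in> E\<^sup>*" "w \<in> W"
  obtains q k where "q 0 \<in> W" "q 1 = x" "q k \<in> W" "1 \<le> k" "\<And>i. i < k \<Longrightarrow> (q i, q (Suc i)) \<in> E"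
    "\<And>i j z. 1 \<le> i \<Longrightarrow> i < j \<Longrightarrow> j \<le> k \<Longrightarrow> (q i, z) \<in> E \<Longrightarrow> (z, q j) \<in> E \<Longrightarrow> j \<le> i + 2"
proof -
  define n where "n = (LEAST n. \<exists>w\<in>W. (x, w) \<in> E ^^ n)"
  have "\<exists>n. \<exists>w\<in>W. (x, w) \<in> E ^^ n" using xw rtrancl_imp_relpow by blast
  then have n: "\<exists>w\<in>W. (x, w) \<in> E ^^ n" unfolding n_def by (rule LeastI_ex)
  then obtain f where f: "f 0 = x" "f n \<in> W" "\<And>i. i < n \<Longrightarrow> (f i, f (Suc i)) \<in> E"
    unfolding relpow_fun_conv by blast
  define q where "q i = (case i of 0 \<Rightarrow> p | Suc j \<Rightarrow> f j)" for i
  have seg: "(f i, f j) \<in> E ^^ (j - i)" if "i \<le> j" "j \<le> n" for i j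
    unfolding relpow_fun_conv
    using that f(3) by (intro exI[of _ "\<lambda>l. f (i + l)"]) auto
  show ?thesis
  proof (rule that[of q "Suc n"])
    fix i assume "i < Suc n"
    then show "(q i, q (Suc i)) \<in> E" using f px(1) by (cases i) (auto simp: q_def)
  next
    fix i j z assume ij: "1 \<le> i" "i < j" "j \<le> Suc n" "(q i, z) \<in> E" "(z, q j) \<in> E"
    then obtain i' j' where ij': "i = Suc i'" "j = Suc j'" by (metis Suc_le_D One_nat_def less_imp_Suc_add)
    have "(x, f i') \<in> E ^^ i'" using seg[of 0 i'] ij ij' f(1) by simp
    then have "(x, z) \<in> E ^^ Suc i'" using ij(4) ij' by (auto simp: q_def)
    then have "(x, f j') \<in> E ^^ Suc (Suc i')" using ij(5) ij'
      by (simp add: q_def) blast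
    moreover have "(f j', f n) \<in> E ^^ (n - j')" using seg[of j' n] ij ij' by simp
    ultimately have "(x, f n) \<in> E ^^ (Suc (Suc i') + (n - j'))"
      unfolding relpow_add by blast
    then have "\<exists>w\<in>W. (x, w) \<in> E ^^ (Suc (Suc i') + (n - j'))" using f(2) by blast
    then have "n \<le> Suc (Suc i') + (n - j')" by (subst n_def) (rule Least_le)
    then show "j \<le> i + 2" using ij ij' by simp
  qed (use f px in \<open>auto simp: q_def\<close>)
qed

definition first_contact :: "'a rel \<Rightarrow> (nat \<Rightarrow> 'a) \<Rightarrow> 'a \<Rightarrow> nat" where
  "first_contact E q z = (LEAST i. q i \<in> cnbr E z)"

lemma first_contact_converse [simp]: "first_contact (E\<inverse>) = first_contact E"
  by (simp add: first_contact_def fun_eq_iff)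

lemma first_contact_le: "q i \<in> cnbr E z \<Longrightarrow> first_contact E q z \<le> i"
  unfolding first_contact_def by (rule Least_le)

lemma first_contact_mem: "q i \<in> cnbr E z \<Longrightarrow> q (first_contact E q z) \<in> cnbr E z"
  unfolding first_contact_def by (rule LeastI)

text \<open>If the first contact were \<open>z\<close> itself, its predecessor on the walk would
  touch \<open>z\<close> earlier.\<close>

lemma first_contact_neq:
  assumes "\<And>i. i < k \<Longrightarrow> (q i, q (Suc i)) \<in> E" "q 0 \<notin> cnbr E z" "q i \<in> cnbr E z" "i \<le> k"
  shows "0 < first_contact E q z" "q (first_contact E q z) \<noteq> z"
proof -
  have "first_contact E q z \<noteq> 0" using first_contact_mem[of q i E z] assms(2,3) by metis
  then show "0 < first_contact E q z" by simp
  then obtain j where j: "first_contact E q z = Suc j" using gr0_implies_Suc by blast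
  then have "(q j, q (Suc j)) \<in> E" using first_contact_le[of q i E z] assms(1,3,4) by simp
  then show "q (first_contact E q z) \<noteq> z"
    using first_contact_le[of q j E z] j by (auto simp: mem_cnbr)
qed

context broom_free
begin

text \<open>The predecessor of the first contact is nonadjacent to \<open>z\<close>, so these two
  and \<open>z\<close> serve as \<open>v1\<close>, \<open>v2\<close>, \<open>v3\<close>. The walk
  runs from \<open>v1\<close> to \<open>v2\<close>, which fits the first broom if
  \<open>\<not> b1\<close> and the second if \<open>b2\<close>.\<close>

lemma thin_first_contact:
  assumes walk: "\<And>i. i < k \<Longrightarrow> (q i, q (Suc i)) \<in> E" "q 0 \<notin> cnbr E z" "q i \<in> cnbr E z" "i \<le> k"
    and signs: "(q (first_contact E q z), z) \<in> E \<and> \<not> b1 \<or> (z, q (first_contact E q z)) \<in> E \<and> b2"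
    and T: "\<And>i. i \<le> first_contact E q z \<Longrightarrow> T \<inter> cnbr E (q i) = {}"
  shows "thin E R z T"
proof -
  obtain j where j: "first_contact E q z = Suc j"
    using first_contact_neq(1)[OF walk] gr0_implies_Suc by blast
  have "q j \<notin> cnbr E z" using first_contact_le[of q j E z] j by auto
  moreover have "(q j, q (Suc j)) \<in> E" using first_contact_le[of q i E z] walk(1,3,4) j by simp
  moreover have "T \<inter> cnbr E (q j) = {}" "T \<inter> cnbr E (q (Suc j)) = {}" using T j by auto
  ultimately show ?thesis
    using signs j thin1[of "q (Suc j)" z "q j" T] thin2[of z "q (Suc j)" "q j" T]
    by (auto simp: sgn_nbr_def)
qed

text \<open>Peeling in the order of first contacts: vertices with a later first contact avoid both
  the first contact \<open>q i\<close> of \<open>z\<close> and its predecessor on the walk.\<close>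

lemma dicol_first_contact:
  assumes S: "finite S"
    and walk: "\<And>i. i < k \<Longrightarrow> (q i, q (Suc i)) \<in> E" "\<And>z. z \<in> S \<Longrightarrow> q 0 \<notin> cnbr E z"
    and contact: "\<And>z. z \<in> S \<Longrightarrow> \<exists>i\<le>k. q i \<in> cnbr E z"
    and signs: "\<And>z. z \<in> S \<Longrightarrow>
      (q (first_contact E q z), z) \<in> E \<and> \<not> b1 \<or> (z, q (first_contact E q z)) \<in> E \<and> b2"
  shows "dicol E S (2 * h * R)"
proof (rule dicol_if_peelable[OF S fin])
  fix S' assume S': "S' \<subseteq> S" "S' \<noteq> {}"
  let ?f = "first_contact E q"
  obtain z0 where z0: "z0 \<in> S'" "\<And>z. z \<in> S' \<Longrightarrow> ?f z0 \<le> ?f z"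
    using ex_has_least_nat[of "\<lambda>z. z \<in> S'" _ ?f] S'(2) by blast
  let ?Q = "S' \<inter> cnbr E (q (?f z0))"
  have "thin E R z (S' - ?Q)" if z: "z \<in> ?Q" for z
  proof -
    have zS: "z \<in> S" using z S' by blast
    then obtain i where i: "i \<le> k" "q i \<in> cnbr E z" using contact by blast
    have "?f z \<le> ?f z0" using z by (intro first_contact_le) (simp add: cnbr_sym[of _ E z])
    then have eq: "?f z = ?f z0" using z0(2)[of z] z by simp
    have "(S' - ?Q) \<inter> cnbr E (q j) = {}" if j: "j \<le> ?f z" for j
    proof (rule ccontr)
      assume "\<not> ?thesis"
      then obtain w where w: "w \<in> S'" "w \<notin> ?Q" "w \<in> cnbr E (q j)" by blast
      then have "?f w \<le> j" by (intro first_contact_le) (simp add: cnbr_sym[of _ E w])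
      then have "j = ?f z0" using z0(2)[OF w(1)] j eq by simp
      with w show False by blast
    qed
    then show ?thesis using thin_first_contact[OF walk(1) walk(2)[OF zS] i(2,1) signs[OF zS]] by blast
  qed
  moreover have "dicol E ?Q h" by (rule dicol_mono[OF nbh]) auto
  moreover have "?Q \<noteq> {}"
  proof -
    obtain i where "q i \<in> cnbr E z0" using contact z0(1) S' by blast
    then have "q (?f z0) \<in> cnbr E z0" by (rule first_contact_mem)
    then show ?thesis using z0(1) cnbr_sym[of _ E z0] by blast
  qed
  ultimately show "peelable E R h S'" unfolding peelable_def by (intro exI[of _ ?Q]) blast
qed

text \<open>The first and the last contact each offer a broom, the last one through the reversed
  walk. A vertex that fits neither receives an arc from its first contact and sends one to its last,
  so it lies between core vertices.\<close>

lemma peelable_along_walk: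
  assumes b: "b1 \<or> b2" and R: "0 < R" and S: "finite S"
    and walk: "\<And>i. i < k \<Longrightarrow> (q i, q (Suc i)) \<in> E"
    and ends: "\<And>z. z \<in> S \<Longrightarrow> q 0 \<notin> cnbr E z" "\<And>z. z \<in> S \<Longrightarrow> q k \<notin> cnbr E z"
    and short: "\<And>i j z. 1 \<le> i \<Longrightarrow> i < j \<Longrightarrow> j \<le> k \<Longrightarrow> (q i, z) \<in> E \<Longrightarrow> (z, q j) \<in> E \<Longrightarrow> j \<le> i + 2"
    and meet: "S \<inter> (\<Union>a\<in>q ` {..k}. cnbr E a) \<noteq> {}"
  shows "peelable E R (2 * h * R + 2 * h * R + 3 * (2 * (h + 2 * h * R) * R) + 2 * h * R) S"
proof -
  let ?N = "\<Union>a\<in>q ` {..k}. cnbr E a"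
  let ?r = "\<lambda>i. q (k - i)"
  define f where "f = first_contact E q"
  define l where "l = first_contact E ?r"
  define F where "F = {z \<in> S \<inter> ?N. (q (f z), z) \<in> E \<and> \<not> b1 \<or> (z, q (f z)) \<in> E \<and> b2}"
  define L where "L = {z \<in> S \<inter> ?N. (?r (l z), z) \<in> E\<inverse> \<and> \<not> b2 \<or> (z, ?r (l z)) \<in> E\<inverse> \<and> b1}"
  \<comment> \<open>Vertices in \<open>T\<close> touch the walk only in a window of three consecutive vertices, since otherwise
    they would shorten it; sorting them by the first contact modulo 3 separates the windows.\<close>
  define T where "T = {z \<in> S \<inter> ?N. (q (f z), z) \<in> E \<and> (z, ?r (l z)) \<in> E}"
  interpret rev: broom_free "E\<inverse>" R h b2 e2 b1 e1 by (rule converse)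
  have rwalk: "(?r i, ?r (Suc i)) \<in> E\<inverse>" if "i < k" for i
    using walk[of "k - Suc i"] that by (simp add: Suc_diff_Suc)
  have rends: "?r 0 \<notin> cnbr E z" if "z \<in> S" for z using ends(2) that by simp
  have contact: "\<exists>i\<le>k. q i \<in> cnbr E z" if "z \<in> S \<inter> ?N" for z
    using that cnbr_sym[of z E] by blast
  have rcontact: "\<exists>i\<le>k. ?r i \<in> cnbr E z" if "z \<in> S \<inter> ?N" for z
    using contact[OF that] diff_le_self diff_diff_cancel by metis
  have f: "q (f z) \<in> cnbr E z" "q (f z) \<noteq> z" "0 < f z" "f z \<le> k" if z: "z \<in> S \<inter> ?N" for z
  proof -
    obtain i where i: "i \<le> k" "q i \<in> cnbr E z" using contact[OF z] by blast
    show "q (f z) \<in> cnbr E z" unfolding f_def using i(2) by (rule first_contact_mem)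
    show "q (f z) \<noteq> z" "0 < f z"
      unfolding f_def using first_contact_neq[of k q E z i] walk ends i z by auto
    show "f z \<le> k" using first_contact_le[of q i E z] i by (simp add: f_def)
  qed
  have l: "?r (l z) \<in> cnbr E z" "?r (l z) \<noteq> z" "0 < l z" "l z \<le> k" if z: "z \<in> S \<inter> ?N" for z
  proof -
    obtain i where i: "i \<le> k" "?r i \<in> cnbr E z" using rcontact[OF z] by blast
    show "?r (l z) \<in> cnbr E z" unfolding l_def using i(2) by (rule first_contact_mem)
    show "?r (l z) \<noteq> z" "0 < l z"
      unfolding l_def using first_contact_neq[of k ?r "E\<inverse>" z i] rwalk rends i z by auto
    show "l z \<le> k" using first_contact_le[of ?r i E z] i by (simp add: l_def)
  qed
  have range: "f z \<le> j" "j \<le> k - l z" if "z \<in> S" "j \<le> k" "q j \<in> cnbr E z" for z j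
    using first_contact_le[of q j E z] first_contact_le[of ?r "k - j" E z] that
    by (auto simp: f_def l_def)
  \<comment> \<open>Missing both \<open>F\<close> and \<open>L\<close> forces, by
    \<open>b1 \<or> b2\<close>, both signs to be true; then only the orientation in \<open>T\<close>
    remains.\<close>
  have cover: "z \<in> F \<or> z \<in> L \<or> z \<in> T" if z: "z \<in> S \<inter> ?N" for z
    using f(1,2)[OF z] l(1,2)[OF z] z b unfolding F_def L_def T_def mem_cnbr converse_iff
    by blast
  have window: "k - l z \<le> f z + 2" if z: "z \<in> T" for z
  proof -
    have zS: "z \<in> S \<inter> ?N" and E: "(q (f z), z) \<in> E" "(z, ?r (l z)) \<in> E"
      using z by (auto simp: T_def)
    have "f z \<le> k - l z" using range(1)[of z "k - l z"] l(1)[OF zS] zS by simp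
    moreover have "f z \<noteq> k - l z" using E asym by auto
    ultimately show ?thesis using short[of "f z" "k - l z" z] f(3)[OF zS] E by simp
  qed
  have "dicol E F (2 * h * R)"
    by (rule dicol_first_contact[of F k q])
      (use S walk ends contact in \<open>auto simp: F_def f_def\<close>)
  moreover have "dicol E L (2 * h * R)"
  proof -
    have "dicol (E\<inverse>) L (2 * h * R)"
    proof (rule rev.dicol_first_contact[of L k ?r])
      fix z assume "z \<in> L"
      then show "\<exists>i\<le>k. ?r i \<in> cnbr (E\<inverse>) z" using rcontact[of z] by (simp add: L_def)
    next
      fix z assume "z \<in> L"
      then show "(?r (first_contact (E\<inverse>) ?r z), z) \<in> E\<inverse> \<and> \<not> b2
          \<or> (z, ?r (first_contact (E\<inverse>) ?r z)) \<in> E\<inverse> \<and> b1"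
        by (simp add: L_def l_def)
    qed (use S rwalk rends in \<open>auto simp: L_def\<close>)
    then show ?thesis by simp
  qed
  moreover have "dicol E T (3 * (2 * (h + 2 * h * R) * R))"
  proof -
    have "dicol E {z \<in> T. f z mod 3 = \<rho>} (2 * (h + 2 * h * R) * R)" for \<rho>
    proof (rule dicol_if_peelable[OF _ fin])
      fix T' assume T': "T' \<subseteq> {z \<in> T. f z mod 3 = \<rho>}" "T' \<noteq> {}"
      then obtain z0 where z0: "z0 \<in> T'" by blast
      let ?i = "f z0"
      \<comment> \<open>The core is the window of \<open>z0\<close>; it contains the first and last
        contact of every vertex of \<open>T'\<close> that it touches.\<close>
      let ?A = "q ` {j. j \<le> k \<and> ?i \<le> j \<and> j \<le> ?i + 2}"
      have T'S: "z \<in> S \<inter> ?N" "z \<in> T" "f z mod 3 = ?i mod 3" if "z \<in> T'" for z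
        using that T' z0 by (auto simp: T_def)
      have near: "f z = ?i" if z: "z \<in> T' \<inter> (\<Union>a\<in>?A. cnbr E a)" for z
      proof -
        obtain j where j: "j \<le> k" "?i \<le> j" "j \<le> ?i + 2" "q j \<in> cnbr E z"
          using z cnbr_sym[of z E] by blast
        have "f z \<le> ?i + 2" "?i \<le> f z + 2"
          using range[OF _ j(1,4)] j T'S[of z] z window[of z] by auto
        moreover have "f z mod 3 = ?i mod 3" using T'S(3)[of z] z by blast
        ultimately show ?thesis by presburger
      qed
      show "peelable E R (h + 2 * h * R) T'"
      proof (rule peelable_core[of T' ?A])
        show "finite T'" using S T' finite_subset[of T' S] by (auto simp: T_def)
        show "T' \<inter> (\<Union>a\<in>?A. cnbr E a) \<noteq> {}"
        proof -
          have "z0 \<in> cnbr E (q ?i)" using f(1)[OF T'S(1)[OF z0]] cnbr_sym[of z0 E] by blast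
          moreover have "q ?i \<in> ?A" using f(4)[OF T'S(1)[OF z0]] by simp
          ultimately show ?thesis using z0 by blast
        qed
        have "T' \<inter> (\<Union>a\<in>?A. cnbr E a) \<subseteq> cnbr E (q ?i)"
        proof
          fix z assume z: "z \<in> T' \<inter> (\<Union>a\<in>?A. cnbr E a)"
          then show "z \<in> cnbr E (q ?i)"
            using near[OF z] f(1)[OF T'S(1), of z] cnbr_sym[of z E] by auto
        qed
        then show "dicol E (T' \<inter> (\<Union>a\<in>?A. cnbr E a)) h" by (rule dicol_mono[OF nbh]) simp
      next
        fix z assume z: "z \<in> T' \<inter> (\<Union>a\<in>?A. cnbr E a)"
        have zT: "z \<in> S \<inter> ?N" "z \<in> T" using z T'S[of z] by auto
        have "(q (f z), z) \<in> E" "(z, ?r (l z)) \<in> E" using zT by (auto simp: T_def)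
        moreover have "q (f z) \<in> ?A" using near[OF z] f(4)[OF zT(1)] by simp
        moreover have "?r (l z) \<in> ?A"
          using window[OF zT(2)] near[OF z] range(1)[of z "k - l z"] l(1)[OF zT(1)] zT(1) by auto
        ultimately show "thin E R z (T' - (\<Union>a\<in>?A. cnbr E a)) \<or>
          (\<exists>a\<in>?A. \<exists>b\<in>?A. (a, z) \<in> E \<and> (z, b) \<in> E)" by blast
      qed (rule R)
    qed (use S in \<open>auto simp: T_def\<close>)
    then have "dicol E (\<Union>\<rho>\<in>{..<3}. {z \<in> T. f z mod 3 = \<rho>})
        (card {..<3::nat} * (2 * (h + 2 * h * R) * R))"
      by (intro dicol_UN) auto
    moreover have "T \<subseteq> (\<Union>\<rho>\<in>{..<3}. {z \<in> T. f z mod 3 = \<rho>})" by auto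
    ultimately show ?thesis by (rule dicol_mono) simp
  qed
  ultimately have "dicol E ((F \<union> L) \<union> T) (2 * h * R + 2 * h * R + 3 * (2 * (h + 2 * h * R) * R))"
    by (intro dicol_Un)
  then have m: "dicol E (S \<inter> ?N) (2 * h * R + 2 * h * R + 3 * (2 * (h + 2 * h * R) * R))"
    by (rule dicol_mono) (use cover in auto)
  \<comment> \<open>The core is now the whole walk: members of \<open>F\<close> and \<open>L\<close>
    are thin, members of \<open>T\<close> lie between walk vertices.\<close>
  show ?thesis
  proof (rule peelable_core[OF S R meet m])
    fix z assume z: "z \<in> S \<inter> ?N"
    have disjoint: "(S - ?N) \<inter> cnbr E (q i) = {}" if "i \<le> k" for i using that by blast
    obtain i where i: "i \<le> k" "q i \<in> cnbr E z" using contact[OF z] by blast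
    obtain i' where i': "i' \<le> k" "?r i' \<in> cnbr E z" using rcontact[OF z] by blast
    from cover[OF z] consider "z \<in> F" | "z \<in> L" | "z \<in> T" by blast
    then show "thin E R z (S - ?N) \<or> (\<exists>a\<in>q ` {..k}. \<exists>b\<in>q ` {..k}. (a, z) \<in> E \<and> (z, b) \<in> E)"
    proof cases
      case 1
      have "thin E R z (S - ?N)"
      proof (rule thin_first_contact[OF walk ends(1) i(2,1)])
        fix j assume "j \<le> first_contact E q z"
        then show "(S - ?N) \<inter> cnbr E (q j) = {}"
          using f(4)[OF z] by (intro disjoint) (simp add: f_def)
      qed (use 1 z in \<open>auto simp: F_def f_def\<close>)
      then show ?thesis ..
    next
      case 2
      have "thin (E\<inverse>) R z (S - ?N)"
      proof (rule rev.thin_first_contact[of k ?r z i'])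
        fix j assume "j \<le> first_contact (E\<inverse>) ?r z"
        show "(S - ?N) \<inter> cnbr (E\<inverse>) (?r j) = {}" using disjoint[of "k - j"] by simp
      next
        show "(?r (first_contact (E\<inverse>) ?r z), z) \<in> E\<inverse> \<and> \<not> b2
          \<or> (z, ?r (first_contact (E\<inverse>) ?r z)) \<in> E\<inverse> \<and> b1"
          using 2 by (simp add: L_def l_def)
      qed (use z rwalk rends i' in auto)
      then show ?thesis by simp
    next
      case 3
      then have "(q (f z), z) \<in> E" "(z, ?r (l z)) \<in> E" by (auto simp: T_def)
      moreover have "q (f z) \<in> q ` {..k}" "?r (l z) \<in> q ` {..k}" using f(4)[OF z] by auto
      ultimately show ?thesis by blast
    qed
  qed
qed

lemma dicol_case_walk:
  assumes b: "b1 \<or> b2" and R: "0 < R" and V: "finite V" "E \<subseteq> V \<times> V"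
    and strong: "\<And>W. W \<subseteq> V \<Longrightarrow> W \<noteq> {} \<Longrightarrow> W \<noteq> V \<Longrightarrow> \<exists>u v. (u, v) \<in> E \<and> u \<in> W \<and> v \<notin> W"
  shows "dicol E V (h + 2 * (2 * h * R + 2 * h * R + 3 * (2 * (h + 2 * h * R) * R) + 2 * h * R) * R)"
proof (cases "V = {}")
  case False
  then obtain r where r: "r \<in> V" by blast
  let ?m = "2 * h * R + 2 * h * R + 3 * (2 * (h + 2 * h * R) * R) + 2 * h * R"
  have "dicol E (V - cnbr E r) (2 * ?m * R)"
  proof (rule dicol_if_peelable[OF _ fin])
    fix S assume S: "S \<subseteq> V - cnbr E r" "S \<noteq> {}"
    define W where "W = {v \<in> V. cnbr E v \<inter> S = {}}"
    have rW: "r \<in> W" using r S by (auto simp: W_def)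
    have "W \<noteq> V" using S by (auto simp: W_def cnbr_def)
    moreover have "W \<subseteq> V" by (auto simp: W_def)
    ultimately obtain p x where px: "(p, x) \<in> E" "p \<in> W" "x \<notin> W"
      using strong[of W] rW by blast
    have xV: "x \<in> V" using px(1) V(2) by blast
    \<comment> \<open>The set reachable from \<open>x\<close> is closed under out-arcs, so the cut
      condition makes it all of \<open>V\<close>; thus the walk can return to \<open>r\<close> in
      \<open>W\<close>.\<close>
    have "E\<^sup>* `` {x} \<subseteq> V"
    proof
      fix y assume "y \<in> E\<^sup>* `` {x}"
      then have "(x, y) \<in> E\<^sup>*" by simp
      then show "y \<in> V" by cases (use V(2) xV in auto)
    qed
    moreover have "E\<^sup>* `` {x} \<noteq> {}" by blast
    moreover have "\<not> (\<exists>u v. (u, v) \<in> E \<and> u \<in> E\<^sup>* `` {x} \<and> v \<notin> E\<^sup>* `` {x})"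
      by (auto intro: rtrancl_into_rtrancl)
    ultimately have "E\<^sup>* `` {x} = V" using strong[of "E\<^sup>* `` {x}"] by metis
    then have xr: "(x, r) \<in> E\<^sup>*" using r by blast
    obtain q k where q: "q 0 \<in> W" "q 1 = x" "q k \<in> W" "1 \<le> k" "\<And>i. i < k \<Longrightarrow> (q i, q (Suc i)) \<in> E"
      "\<And>i j z. 1 \<le> i \<Longrightarrow> i < j \<Longrightarrow> j \<le> k \<Longrightarrow> (q i, z) \<in> E \<Longrightarrow> (z, q j) \<in> E \<Longrightarrow> j \<le> i + 2"
      using shortest_return_walk[OF px(1,2) xr rW] by blast
    have W: "w \<notin> cnbr E z" if "w \<in> W" "z \<in> S" for w z
      using that cnbr_sym[of w E z] by (auto simp: W_def)
    have "S \<inter> cnbr E x \<noteq> {}" using px(3) xV by (auto simp: W_def)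
    moreover have "x \<in> q ` {..k}" using q(2,4) by (intro image_eqI[of _ _ 1]) auto
    ultimately have "S \<inter> (\<Union>a\<in>q ` {..k}. cnbr E a) \<noteq> {}" by blast
    then show "peelable E R ?m S"
      using finite_subset[of S V] S V q(5,6) W[OF q(1)] W[OF q(3)]
      by (intro peelable_along_walk[OF b R, of S k q]) auto
  qed (use V in simp)
  then have "dicol E (cnbr E r \<union> (V - cnbr E r)) (h + 2 * ?m * R)" by (intro dicol_Un nbh)
  then show ?thesis by (rule dicol_mono) auto
qed simp

end

section \<open>Combining the cases for strongly connected digraphs\<close>

context broom_free
begin

text \<open>An outward star in the second broom is handled by reversing all arcs. Adding the bounds
  of the cases gives one bound independent of the signs.\<close>

lemma dicol_strongly_connected:
  assumes R: "0 < R" and V: "finite V" "E \<subseteq> V \<times> V"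
    and strong: "\<And>W. W \<subseteq> V \<Longrightarrow> W \<noteq> {} \<Longrightarrow> W \<noteq> V \<Longrightarrow> \<exists>u v. (u, v) \<in> E \<and> u \<in> W \<and> v \<notin> W"
    and ram: "\<And>n S. finite S \<Longrightarrow> ram n \<le> card S \<Longrightarrow> \<exists>I\<subseteq>S. card I = n \<and> stable_set E I"
  shows "dicol E V
    ((h + 2 * (2 * h * R + 2 * h * R + 3 * (2 * (h + 2 * h * R) * R) + 2 * h * R) * R)
    + (h + 2 * (2 * h + 2 * (2 * h + 2 * h * R) * R) * R)
    + 2 * ((4 * R + 2 * R * ram (R + 1)) * h
      + 2 * (2 * ram (1 + 2 * R * R + 2 * R)) * (2 * h * (2 * R))) * R)"
    (is "dicol E V (?c1 + ?c2 + ?c3)")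
proof -
  consider "b1 \<or> b2" | "\<not> b1" "\<not> b2" "e1" | "\<not> b1" "\<not> b2" "e2" | "\<not> b1" "\<not> b2" "\<not> e1" "\<not> e2"
    by blast
  then have "dicol E V ?c1 \<or> dicol E V ?c2 \<or> dicol E V ?c3"
  proof cases
    case 1
    then show ?thesis using dicol_case_walk[OF 1 R V strong] by blast
  next
    case 2
    then show ?thesis using dicol_case_out[OF 2 R V strong] by blast
  next
    case 3
    interpret rev: broom_free "E\<inverse>" R h b2 e2 b1 e1 by (rule converse)
    have "\<exists>u v. (u, v) \<in> E\<inverse> \<and> u \<in> W \<and> v \<notin> W" if W: "W \<subseteq> V" "W \<noteq> {}" "W \<noteq> V" for W
    proof -
      have "V - W \<subseteq> V" "V - W \<noteq> {}" "V - W \<noteq> V" using W by auto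
      from strong[OF this] show ?thesis using V(2) by blast
    qed
    moreover have "E\<inverse> \<subseteq> V \<times> V" using V(2) by blast
    ultimately have "dicol (E\<inverse>) V ?c2" using rev.dicol_case_out[OF 3(2,1,3) R V(1)] by blast
    then show ?thesis by simp
  next
    case 4
    interpret ramsey_broom_free E R h b1 e1 b2 e2 ram
      by unfold_locales (use ram R 4 in auto)
    show ?thesis using dicol_case_in[OF V(1)] by blast
  qed
  then show ?thesis
  proof (elim disjE)
    assume "dicol E V ?c1" then show ?thesis by (rule dicol_mono) simp_all
  next
    assume "dicol E V ?c2" then show ?thesis by (rule dicol_mono) simp_all
  next
    assume "dicol E V ?c3" then show ?thesis by (rule dicol_mono) simp_all
  qed
qed

end

section \<open>Induction on the order of the transitive tournament\<close>

text \<open>Choosing the source first makes out-neighbourhoods in a set without order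
  \<open>Suc t\<close> free of order \<open>t\<close>, as the induction requires.\<close>

fun has_tt :: "'a rel \<Rightarrow> 'a set \<Rightarrow> nat \<Rightarrow> bool" where
  "has_tt E S 0 = True"
| "has_tt E S (Suc t) = (\<exists>v\<in>S. has_tt E (S \<inter> E `` {v}) t)"

lemma has_tt_mono: "has_tt E S t \<Longrightarrow> E \<subseteq> F \<Longrightarrow> S \<subseteq> T \<Longrightarrow> has_tt F T t"
proof (induction t arbitrary: S T)
  case (Suc t)
  then obtain v where v: "v \<in> S" "has_tt E (S \<inter> E `` {v}) t" by auto
  have "S \<inter> E `` {v} \<subseteq> T \<inter> F `` {v}" using Suc.prems by blast
  from Suc.IH[OF v(2) Suc.prems(2) this] v(1) Suc.prems(3) show ?case by auto
qed simp

text \<open>The mirror image of the recursion, with \<open>v\<close> added as a sink; it serves the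
  induction on in-neighbourhoods.\<close>

lemma has_tt_append: "has_tt E (S \<inter> E\<inverse> `` {v}) t \<Longrightarrow> v \<in> S \<Longrightarrow> has_tt E S (Suc t)"
proof (induction t arbitrary: S)
  case (Suc t)
  then obtain u where u: "u \<in> S" "(u, v) \<in> E" "has_tt E (S \<inter> E\<inverse> `` {v} \<inter> E `` {u}) t" by auto
  have "has_tt E (S \<inter> E `` {u} \<inter> E\<inverse> `` {v}) t" by (rule has_tt_mono[OF u(3)]) auto
  from Suc.IH[OF this] u Suc.prems(2) have "has_tt E (S \<inter> E `` {u}) (Suc t)" by blast
  with u(1) show ?case unfolding has_tt.simps(2)[of E S "Suc t"] by blast
qed auto

text \<open>By pigeonhole the out- or in-neighbourhood of any vertex has at least half the required
  size; that vertex becomes the source or the sink.\<close>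

lemma has_tt_tournament:
  assumes "finite K" "2 ^ t \<le> card K" "\<And>u v. u \<in> K \<Longrightarrow> v \<in> K \<Longrightarrow> u \<noteq> v \<Longrightarrow> (u, v) \<in> E \<or> (v, u) \<in> E"
  shows "has_tt E K t"
  using assms
proof (induction t arbitrary: K)
  case (Suc t)
  have "(0::nat) < 2 ^ Suc t" by simp
  then have "0 < card K" using Suc.prems(2) by linarith
  then obtain v where v: "v \<in> K" by (auto simp: card_gt_0_iff)
  let ?A = "K \<inter> E `` {v}" and ?B = "K \<inter> E\<inverse> `` {v}"
  have "K \<subseteq> insert v (?A \<union> ?B)" using Suc.prems(3) v by blast
  then have "card K \<le> card (insert v (?A \<union> ?B))" using Suc.prems(1) by (intro card_mono) auto
  also have "\<dots> \<le> Suc (card (?A \<union> ?B))" using Suc.prems(1) by (simp add: card_insert_if)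
  also have "\<dots> \<le> Suc (card ?A + card ?B)" using card_Un_le by simp
  finally have "2 ^ t \<le> card ?A \<or> 2 ^ t \<le> card ?B" using Suc.prems(2) by auto
  then show ?case
  proof
    assume "2 ^ t \<le> card ?A"
    then have "has_tt E ?A t" using Suc.prems by (intro Suc.IH) auto
    with v show ?thesis by auto
  next
    assume "2 ^ t \<le> card ?B"
    then have "has_tt E ?B t" using Suc.prems by (intro Suc.IH) auto
    then show ?thesis using v by (rule has_tt_append)
  qed
qed simp

lemma cnbr_restrict: "u \<in> W \<Longrightarrow> v \<in> W \<Longrightarrow> u \<in> cnbr (E \<inter> W \<times> W) v \<longleftrightarrow> u \<in> cnbr E v"
  by (auto simp: mem_cnbr)

lemma sgn_nbr_restrict: "u \<in> sgn_nbr (E \<inter> W \<times> W) b v \<longleftrightarrow> u \<in> W \<and> v \<in> W \<and> u \<in> sgn_nbr E b v"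
  by (auto simp: sgn_nbr_def)

lemma broomless_restrict:
  assumes "broomless E R b e" "finite E"
  shows "broomless (E \<inter> W \<times> W) R b e"
  unfolding broomless_def
proof (intro allI impI)
  let ?E = "E \<inter> W \<times> W"
  fix p q z assume *: "(q, z) \<in> ?E" "p \<in> sgn_nbr ?E b q" "p \<notin> cnbr ?E z"
  then have W: "p \<in> W" "q \<in> W" "z \<in> W" "p \<in> sgn_nbr E b q" by (auto simp: sgn_nbr_restrict)
  have "card (sgn_nbr ?E e z - cnbr ?E p - cnbr ?E q) \<le> card (sgn_nbr E e z - cnbr E p - cnbr E q)"
  proof (rule card_mono)
    show "finite (sgn_nbr E e z - cnbr E p - cnbr E q)"
      using assms(2) by (simp add: sgn_nbr_def finite_Image)
    show "sgn_nbr ?E e z - cnbr ?E p - cnbr ?E q \<subseteq> sgn_nbr E e z - cnbr E p - cnbr E q"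
      using W by (auto simp: sgn_nbr_restrict cnbr_restrict)
  qed
  also have "\<dots> < R"
    using assms(1) * W cnbr_restrict[OF W(1,3)] unfolding broomless_def by blast
  finally show "card (sgn_nbr ?E e z - cnbr ?E p - cnbr ?E q) < R" .
qed

text \<open>Out- and in-neighbourhoods contain no transitive tournament of order \<open>t\<close>,
  so with one colour for the vertex itself \<open>h = c + c + 1\<close> bounds closed
  neighbourhoods. The hypothesis ranges over all \<open>E\<close> because it is applied to
  restrictions.\<close>

lemma dicol_broomless:
  fixes R :: nat and ram :: "nat \<Rightarrow> nat"
  assumes R: "0 < R"
  shows "\<exists>c. \<forall>(E::'a rel) V. finite V \<longrightarrow> E \<subseteq> V \<times> V \<longrightarrow> (\<forall>u v. (u, v) \<in> E \<longrightarrow> (v, u) \<notin> E) \<longrightarrow>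
    broomless E R b1 e1 \<longrightarrow> broomless (E\<inverse>) R b2 e2 \<longrightarrow>
    (\<forall>n S. finite S \<longrightarrow> ram n \<le> card S \<longrightarrow> (\<exists>I\<subseteq>S. card I = n \<and> stable_set E I)) \<longrightarrow>
    \<not> has_tt E V t \<longrightarrow> dicol E V c"
proof (induction t)
  case (Suc t)
  then obtain c where IH: "\<And>(E::'a rel) V. finite V \<Longrightarrow> E \<subseteq> V \<times> V \<Longrightarrow>
    (\<And>u v. (u, v) \<in> E \<Longrightarrow> (v, u) \<notin> E) \<Longrightarrow>
    broomless E R b1 e1 \<Longrightarrow> broomless (E\<inverse>) R b2 e2 \<Longrightarrow>
    (\<And>n S. finite S \<Longrightarrow> ram n \<le> card S \<Longrightarrow> \<exists>I\<subseteq>S. card I = n \<and> stable_set E I) \<Longrightarrow>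
    \<not> has_tt E V t \<Longrightarrow> dicol E V c"
    by metis
  define h where "h = c + c + 1"
  define K where "K =
    (h + 2 * (2 * h * R + 2 * h * R + 3 * (2 * (h + 2 * h * R) * R) + 2 * h * R) * R)
    + (h + 2 * (2 * h + 2 * (2 * h + 2 * h * R) * R) * R)
    + 2 * ((4 * R + 2 * R * ram (R + 1)) * h
      + 2 * (2 * ram (1 + 2 * R * R + 2 * R)) * (2 * h * (2 * R))) * R"
  show ?case
  proof (intro exI[of _ K] allI impI)
    fix E :: "'a rel" and V
    assume V: "finite V" "E \<subseteq> V \<times> V" and asym: "\<forall>u v. (u, v) \<in> E \<longrightarrow> (v, u) \<notin> E"
      and bl: "broomless E R b1 e1" "broomless (E\<inverse>) R b2 e2"
      and ram: "\<forall>n S. finite S \<longrightarrow> ram n \<le> card S \<longrightarrow> (\<exists>I\<subseteq>S. card I = n \<and> stable_set E I)"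
      and tt: "\<not> has_tt E V (Suc t)"
    have fin: "finite E" using V finite_subset by blast
    have bl_restrict: "broomless (E \<inter> W \<times> W) R b1 e1" "broomless ((E \<inter> W \<times> W)\<inverse>) R b2 e2" for W
    proof -
      have "(E \<inter> W \<times> W)\<inverse> = E\<inverse> \<inter> W \<times> W" by auto
      then show "broomless (E \<inter> W \<times> W) R b1 e1" "broomless ((E \<inter> W \<times> W)\<inverse>) R b2 e2"
        using broomless_restrict[OF bl(1) fin] broomless_restrict[OF bl(2)] fin by simp_all
    qed
    have ram_restrict: "\<exists>I\<subseteq>S. card I = n \<and> stable_set (E \<inter> W \<times> W) I"
      if large: "finite S" "ram n \<le> card S" for n S W
    proof -
      obtain I where "I \<subseteq> S" "card I = n" "stable_set E I"
        using ram[rule_format, OF large] by blast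
      then show ?thesis unfolding stable_set_def by (intro exI[of _ I]) auto
    qed
    have small: "dicol E N c" if N: "N \<subseteq> V" "\<not> has_tt E N t" for N
    proof -
      have "dicol (E \<inter> N \<times> N) N c"
      proof (rule IH)
        show "finite N" using N(1) V(1) by (rule finite_subset)
        show "\<not> has_tt (E \<inter> N \<times> N) N t" using N(2) has_tt_mono[of "E \<inter> N \<times> N" N t E N] by blast
      qed (use asym bl_restrict ram_restrict in auto)
      then show ?thesis using dicol_cong[of E N "E \<inter> N \<times> N"] by simp
    qed
    have nbh: "dicol E (cnbr E v) h" for v
    proof (cases "v \<in> V")
      case True
      have out: "V \<inter> E `` {v} = E `` {v}" "V \<inter> E\<inverse> `` {v} = E\<inverse> `` {v}" using V(2) by auto
      have "\<not> has_tt E (V \<inter> E `` {v}) t" using tt True by auto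
      moreover have "\<not> has_tt E (V \<inter> E\<inverse> `` {v}) t" using has_tt_append[OF _ True] tt by metis
      ultimately have "\<not> has_tt E (E `` {v}) t" "\<not> has_tt E (E\<inverse> `` {v}) t"
        unfolding out by blast+
      then have "dicol E (E `` {v}) c" "dicol E (E\<inverse> `` {v}) c" using small out by blast+
      moreover have "dicol E {v} 1" by (rule dicol_singleton) (use asym in \<open>auto simp: irrefl_def\<close>)
      ultimately have "dicol E (E `` {v} \<union> E\<inverse> `` {v} \<union> {v}) h"
        unfolding h_def by (intro dicol_Un)
      then show ?thesis by (simp add: cnbr_def)
    next
      case False
      then have "cnbr E v = {v}" using V(2) by (auto simp: cnbr_def)
      moreover have "dicol E {v} 1" by (rule dicol_singleton) (use asym in \<open>auto simp: irrefl_def\<close>)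
      ultimately show ?thesis using dicol_mono[of E "{v}" 1 "{v}" h] by (simp add: h_def)
    qed
    have "dicol E W K" if "W \<subseteq> V" for W
      using finite_subset[OF that V(1)] that
    proof (induction W rule: finite_psubset_induct)
      case (psubset W)
      show ?case
      \<comment> \<open>A set \<open>U\<close> with no arc into the rest lets both parts share a
        palette; without one, the restriction to \<open>W\<close> is strongly connected.\<close>
      proof (cases "\<exists>U. U \<subseteq> W \<and> U \<noteq> {} \<and> U \<noteq> W \<and> E \<inter> U \<times> (W - U) = {}")
        case True
        then obtain U where U: "U \<subseteq> W" "U \<noteq> {}" "U \<noteq> W" "E \<inter> U \<times> (W - U) = {}" by blast
        have "dicol E U K" "dicol E (W - U) K"
          using psubset.IH[of U] psubset.IH[of "W - U"] psubset.prems U by auto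
        then have "dicol E ((W - U) \<union> U) K" using U(4) by (intro dicol_Un_same)
        moreover have "(W - U) \<union> U = W" using U(1) by blast
        ultimately show ?thesis by simp
      next
        case False
        let ?E = "E \<inter> W \<times> W"
        interpret broom_free ?E R h b1 e1 b2 e2
        proof
          fix v
          have "dicol E (cnbr ?E v) h"
            by (rule dicol_mono[OF nbh[of v]]) (auto simp: cnbr_def)
          moreover have "acyclic {(u, w) \<in> E. u \<in> S \<and> w \<in> S \<and> f u = f w} \<Longrightarrow>
              acyclic {(u, w) \<in> ?E. u \<in> S \<and> w \<in> S \<and> f u = f w}" for S and f :: "'a \<Rightarrow> nat"
            by (erule acyclic_subset) auto
          ultimately show "dicol ?E (cnbr ?E v) h" unfolding dicol_def by blast
        qed (use fin asym bl_restrict in auto)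
        have "dicol ?E W K"
          unfolding K_def
        proof (rule dicol_strongly_connected[OF R])
          fix U assume "U \<subseteq> W" "U \<noteq> {}" "U \<noteq> W"
          then show "\<exists>u v. (u, v) \<in> ?E \<and> u \<in> U \<and> v \<notin> U" using False by blast
        qed (use psubset.hyps ram_restrict in auto)
        then show ?thesis using dicol_cong[of E W ?E] by simp
      qed
    qed
    then show "dicol E V K" by simp
  qed
qed simp

section \<open>Induced brooms and tournaments\<close>

lemma not_H_free_if_embedding:
  assumes D: "pair_wf_digraph D" and H: "pair_wf_digraph H"
    and f: "inj_on f (pverts H)" "f ` pverts H \<subseteq> pverts D"
    and arcs: "\<And>u v. u \<in> pverts H \<Longrightarrow> v \<in> pverts H \<Longrightarrow> (u, v) \<in> parcs H \<longleftrightarrow> (f u, f v) \<in> parcs D"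
  shows "\<not> H_free D H"
proof -
  interpret D: pair_wf_digraph D by (rule D)
  interpret H: pair_wf_digraph H by (rule H)
  \<comment> \<open>\<open>H_free\<close> speaks of isomorphisms from the subdigraph to
    \<open>H\<close>, hence the inverse of \<open>f\<close>.\<close>
  define g where "g = the_inv_into (pverts H) f"
  have g: "g (f u) = u" if "u \<in> pverts H" for u
    using the_inv_into_f_f[OF f(1) that] by (simp add: g_def)
  let ?D = "with_proj D \<restriction> (f ` pverts H)"
  define hom where "hom = \<lparr>iso_verts = g, iso_arcs = map_prod g g, iso_head = snd, iso_tail = fst\<rparr>"
  have ind: "induced_subgraph ?D (with_proj D)" using f(2) by (intro D.induced_induce) simp
  have "inj_on g (f ` pverts H)" using g by (auto intro!: inj_onI)
  then have "inj_on (map_prod g g) (f ` pverts H \<times> f ` pverts H)" by (simp add: map_prod_inj_on)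
  then have "inj_on (map_prod g g) (arcs ?D)" by (rule inj_on_subset) auto
  moreover have "wf_digraph ?D" using ind by (auto simp: induced_subgraph_def subgraph_def)
  ultimately have "pre_digraph.digraph_isomorphism ?D hom"
    using \<open>inj_on g (f ` pverts H)\<close> by (auto simp: pre_digraph.digraph_isomorphism_def hom_def)
  moreover have "with_proj H = app_iso hom ?D"
  proof -
    have "g ` f ` pverts H = pverts H" using g by (simp add: image_image)
    moreover have "map_prod g g ` {e \<in> parcs D. fst e \<in> f ` pverts H \<and> snd e \<in> f ` pverts H} = parcs H"
    proof (intro equalityI subsetI)
      fix a assume "a \<in> map_prod g g ` {e \<in> parcs D. fst e \<in> f ` pverts H \<and> snd e \<in> f ` pverts H}"
      then show "a \<in> parcs H" using g arcs by auto
    next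
      fix a assume a: "a \<in> parcs H"
      obtain u v where uv: "a = (u, v)" by (cases a)
      then have V: "u \<in> pverts H" "v \<in> pverts H" using a H.in_arcsD1 H.in_arcsD2 by auto
      have "a = map_prod g g (f u, f v)" using uv g V by simp
      then show "a \<in> map_prod g g ` {e \<in> parcs D. fst e \<in> f ` pverts H \<and> snd e \<in> f ` pverts H}"
        by (rule image_eqI) (use a uv V arcs in auto)
    qed
    ultimately show ?thesis by (simp add: app_iso_def hom_def with_proj_def induce_subgraph_def)
  qed
  ultimately have "digraph_iso ?D (with_proj H)" unfolding digraph_iso_def by blast
  with ind show ?thesis unfolding H_free_def by blast
qed

text \<open>The normal form matching \<open>broomless\<close>. For the opposing broom it describes
  the converse of the arc set.\<close>

definition broom_arcs :: "nat \<Rightarrow> bool \<Rightarrow> bool \<Rightarrow> nat rel" where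
  "broom_arcs r b e = {(2, 3), if b then (2, 1) else (1, 2)}
    \<union> (\<lambda>i. if e then (3, 3 + i) else (3 + i, 3)) ` {1..r}"

lemma broom_arcs_cases:
  assumes sym: "\<And>u v. (u, v) \<in> A \<or> (v, u) \<in> A \<longleftrightarrow> (u, v) \<in> parcs (broom r)"
    and asym: "\<And>u v. (u, v) \<in> A \<Longrightarrow> (v, u) \<notin> A"
    and "(2, 3) \<in> A"
    and star: "(\<forall>i\<in>{1..r}. (3, 3 + i) \<in> A) \<or> (\<forall>i\<in>{1..r}. (3 + i, 3) \<in> A)"
  obtains b e where "A = broom_arcs r b e"
proof -
  define b where "b \<longleftrightarrow> (2, 1) \<in> A"
  have A1: "(2, 1) \<in> A \<longleftrightarrow> b" "(1, 2) \<in> A \<longleftrightarrow> \<not> b"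
    using sym[of 1 2] asym[of 1 2] by (auto simp: b_def broom_def)
  obtain e where e: "\<And>i. i \<in> {1..r} \<Longrightarrow> (3, 3 + i) \<in> A \<longleftrightarrow> e" "\<And>i. i \<in> {1..r} \<Longrightarrow> (3 + i, 3) \<in> A \<longleftrightarrow> \<not> e"
    using star
  proof
    assume *: "\<forall>i\<in>{1..r}. (3, 3 + i) \<in> A"
    then show ?thesis using that[of True] asym by blast
  next
    assume *: "\<forall>i\<in>{1..r}. (3 + i, 3) \<in> A"
    then show ?thesis using that[of False] asym by blast
  qed
  have "A \<subseteq> broom_arcs r b e"
  proof (rule subrelI)
    fix u v assume uv: "(u, v) \<in> A"
    then have "(u, v) \<in> parcs (broom r)" using sym by blast
    then consider "(u, v) = (1, 2)" | "(u, v) = (2, 1)" | "(u, v) = (2, 3)" | "(u, v) = (3, 2)"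
      | i where "i \<in> {1..r}" "(u, v) = (3, 3 + i)" | i where "i \<in> {1..r}" "(u, v) = (3 + i, 3)"
      by (auto simp: broom_def)
    then show "(u, v) \<in> broom_arcs r b e"
      using uv A1 e asym[OF \<open>(2, 3) \<in> A\<close>] unfolding broom_arcs_def
      by cases (auto split: if_splits intro: image_eqI)
  qed
  moreover have "broom_arcs r b e \<subseteq> A"
    using A1 e \<open>(2, 3) \<in> A\<close> by (auto simp: broom_arcs_def split: if_splits)
  ultimately show ?thesis using that by blast
qed

lemma valid_orientation_arcs:
  assumes "valid_orientation r B"
  shows "pair_wf_digraph B" "pverts B = {1..3 + r}"
    "\<And>u v. (u, v) \<in> parcs B \<Longrightarrow> (v, u) \<notin> parcs B"
    "\<And>u v. (u, v) \<in> parcs B \<or> (v, u) \<in> parcs B \<longleftrightarrow> (u, v) \<in> parcs (broom r)"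
    "(\<forall>i\<in>{1..r}. (3, 3 + i) \<in> parcs B) \<or> (\<forall>i\<in>{1..r}. (3 + i, 3) \<in> parcs B)"
proof -
  have or: "oriented_digraph B" and sym: "mk_symmetric (with_proj B) = broom r"
    using assms by (auto simp: valid_orientation_def orientation_of_def)
  interpret oriented_digraph B by (rule or)
  show "pair_wf_digraph B" by unfold_locales
  have "pverts B = {1, 2, 3} \<union> (+) 3 ` {1..r}"
    using arg_cong[OF sym, of pverts] by (simp add: broom_def)
  also have "(+) (3::nat) ` {1..r} = {4..3 + r}"
    by (simp add: image_add_atLeastAtMost add.commute)
  also have "{1, 2, 3} \<union> {4..3 + r} = {1..3 + r}"
  proof (rule set_eqI)
    show "x \<in> {1, 2, 3} \<union> {4..3 + r} \<longleftrightarrow> x \<in> {1..3 + r}" for x :: nat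
      unfolding Un_iff insert_iff empty_iff atLeastAtMost_iff by presburger
  qed
  finally show "pverts B = {1..3 + r}" .
  show "(v, u) \<notin> parcs B" if "(u, v) \<in> parcs B" for u v using no_digon that .
  show "(u, v) \<in> parcs B \<or> (v, u) \<in> parcs B \<longleftrightarrow> (u, v) \<in> parcs (broom r)" for u v
    unfolding sym[symmetric] by (auto simp: parcs_mk_symmetric Bex_def split_paired_Ex)
  show "(\<forall>i\<in>{1..r}. (3, 3 + i) \<in> parcs B) \<or> (\<forall>i\<in>{1..r}. (3 + i, 3) \<in> parcs B)"
    using assms by (simp add: valid_orientation_def)
qed

text \<open>A violation provides a large set at \<open>z\<close>, and a stable
  \<open>r\<close>-subset of it gives the leaves. They are nonadjacent to \<open>p\<close> and
  \<open>q\<close>, and \<open>p\<close> to \<open>z\<close>, so the broom is induced.\<close>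

lemma broom_embedding:
  assumes bl: "\<not> broomless E R b e" and asym: "\<And>u v. (u, v) \<in> E \<Longrightarrow> (v, u) \<notin> E" and fin: "finite E"
    and ram: "\<And>S. finite S \<Longrightarrow> R \<le> card S \<Longrightarrow> \<exists>I\<subseteq>S. card I = r \<and> stable_set E I"
  obtains f where "inj_on f {1..3 + r}" "f ` {1..3 + r} \<subseteq> Field E"
    "\<And>u v. u \<in> {1..3 + r} \<Longrightarrow> v \<in> {1..3 + r} \<Longrightarrow> (u, v) \<in> broom_arcs r b e \<longleftrightarrow> (f u, f v) \<in> E"
proof -
  obtain p q z where pqz: "(q, z) \<in> E" "p \<in> sgn_nbr E b q" "p \<notin> cnbr E z"
      "R \<le> card (sgn_nbr E e z - cnbr E p - cnbr E q)"
    using bl unfolding broomless_def by fastforce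
  have "finite (sgn_nbr E e z - cnbr E p - cnbr E q)"
    using fin by (simp add: sgn_nbr_def finite_Image)
  from ram[OF this pqz(4)] obtain I where
    I: "I \<subseteq> sgn_nbr E e z - cnbr E p - cnbr E q" "card I = r" "stable_set E I" by blast
  have "finite I" using I(1) \<open>finite (sgn_nbr E e z - _ - _)\<close> by (rule finite_subset)
  then obtain w where w: "bij_betw w {1..r} I"
    using I(2) ex_bij_betw_nat_finite_1 by blast
  define f where "f i = (if i = 1 then p else if i = 2 then q else if i = 3 then z else w (i - 3))"
    for i :: nat
  have f: "f 1 = p" "f 2 = q" "f 3 = z" "\<And>i. 1 \<le> i \<Longrightarrow> f (3 + i) = w i" by (simp_all add: f_def)
  have irr: "(v, v) \<notin> E" for v using asym by blast
  have w_mem: "w i \<in> I" if "i \<in> {1..r}" for i using bij_betwE[OF w] that by blast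
  have wI: "w i \<in> sgn_nbr E e z" "w i \<notin> cnbr E p" "w i \<notin> cnbr E q" if "i \<in> {1..r}" for i
    using w_mem[OF that] I(1) by auto
  have ww: "(w i, w j) \<notin> E" if "i \<in> {1..r}" "j \<in> {1..r}" for i j
    using that w_mem I(3) by (auto simp: stable_set_def)
  have w_inj: "i = j" if "w i = w j" "i \<in> {1..r}" "j \<in> {1..r}" for i j
    using that w by (auto simp: bij_betw_def dest: inj_onD)
  have wz: "(w i, z) \<in> E \<longleftrightarrow> \<not> e" "(z, w i) \<in> E \<longleftrightarrow> e" if "i \<in> {1..r}" for i
    using wI(1)[OF that] asym by (auto simp: sgn_nbr_def split: if_splits)
  have wp: "w i \<noteq> p" "(w i, p) \<notin> E" "(p, w i) \<notin> E" "w i \<noteq> q" "(w i, q) \<notin> E" "(q, w i) \<notin> E"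
    if "i \<in> {1..r}" for i
    using wI(2,3)[OF that] by (auto simp: mem_cnbr)
  have pz: "p \<noteq> z" "(p, z) \<notin> E" "(z, p) \<notin> E" using pqz(3) by (auto simp: mem_cnbr)
  have pq: "(p, q) \<in> E \<longleftrightarrow> \<not> b" "(q, p) \<in> E \<longleftrightarrow> b"
    using pqz(2) asym by (auto simp: sgn_nbr_def split: if_splits)
  have V: "u = 1 \<or> u = 2 \<or> u = 3 \<or> (\<exists>i\<in>{1..r}. u = 3 + i)" if "u \<in> {1..3 + r}" for u
  proof (cases "u \<le> 3")
    case False
    then have "u = 3 + (u - 3)" "u - 3 \<in> {1..r}" using that by auto
    then show ?thesis by blast
  qed (use that in auto)
  have neq: "p \<noteq> q" "q \<noteq> z" "(z, q) \<notin> E" using pq irr asym pqz(1) by auto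
  have wz': "w i \<noteq> z" if "i \<in> {1..r}" for i using wz[OF that] irr by metis
  show ?thesis
  proof (rule that[of f])
    show "inj_on f {1..3 + r}"
    proof (rule inj_onI)
      fix u v assume u: "u \<in> {1..3 + r}" and v: "v \<in> {1..3 + r}" and "f u = f v"
      then show "u = v"
        using V[OF u] V[OF v] w_inj
        by (elim disjE bexE) (auto simp: f[simplified] neq neq(1,2)[symmetric] pz pz(1)[symmetric] wz' wp
            wz'[symmetric] wp(1,4)[symmetric])
    qed
    show "f ` {1..3 + r} \<subseteq> Field E"
    proof
      fix x assume "x \<in> f ` {1..3 + r}"
      then obtain u where u: "u \<in> {1..3 + r}" "x = f u" by blast
      then show "x \<in> Field E"
        using V[of u] f pq pqz(1) wz by (auto simp: Field_def) blast+
    qed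
    fix u v assume uv: "u \<in> {1..3 + r}" "v \<in> {1..3 + r}"
    show "(u, v) \<in> broom_arcs r b e \<longleftrightarrow> (f u, f v) \<in> E"
      using V[OF uv(1)] V[OF uv(2)]
      by (elim disjE bexE)
        (auto simp: f[simplified] broom_arcs_def irr pq pqz(1) neq pz wz wp ww split: if_splits)
  qed
qed

lemma has_tt_embedding:
  "has_tt E S t \<Longrightarrow> \<exists>f. (\<forall>i\<in>{1..t}. f i \<in> S) \<and> (\<forall>i j. 1 \<le> i \<longrightarrow> i < j \<longrightarrow> j \<le> t \<longrightarrow> (f i, f j) \<in> E)"
proof (induction t arbitrary: S)
  case (Suc t)
  then obtain v where v: "v \<in> S" "has_tt E (S \<inter> E `` {v}) t" by auto
  from Suc.IH[OF this(2)] obtain f where f: "\<forall>i\<in>{1..t}. f i \<in> S \<inter> E `` {v}"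
      "\<forall>i j. 1 \<le> i \<longrightarrow> i < j \<longrightarrow> j \<le> t \<longrightarrow> (f i, f j) \<in> E" by blast
  define g where "g i = (if i = 1 then v else f (i - 1))" for i
  have "(g i, g j) \<in> E" if ij: "1 \<le> i" "i < j" "j \<le> Suc t" for i j
  proof (cases "i = 1")
    case True
    then have "j - 1 \<in> {1..t}" using ij by auto
    then show ?thesis using True ij f(1) by (auto simp: g_def)
  next
    case False
    then have "1 \<le> i - 1" "i - 1 < j - 1" "j - 1 \<le> t" using ij by auto
    then show ?thesis using f(2) ij False by (auto simp: g_def)
  qed
  moreover have "g i \<in> S" if i: "i \<in> {1..Suc t}" for i
  proof (cases "i = 1")
    case False
    then have "i - 1 \<in> {1..t}" using i by auto
    then show ?thesis using False f(1) by (auto simp: g_def)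
  qed (simp add: g_def v)
  ultimately show ?case by blast
qed simp

lemma not_has_tt_if_TT_free:
  assumes D: "oriented_digraph D" and free: "H_free D (TT t)"
  shows "\<not> has_tt (parcs D) (pverts D) t"
proof
  interpret D: oriented_digraph D by (rule D)
  have irr: "(v, v) \<notin> parcs D" for v using D.no_digon by blast
  assume "has_tt (parcs D) (pverts D) t"
  then obtain f where f: "\<And>i. i \<in> {1..t} \<Longrightarrow> f i \<in> pverts D"
      "\<And>i j. 1 \<le> i \<Longrightarrow> i < j \<Longrightarrow> j \<le> t \<Longrightarrow> (f i, f j) \<in> parcs D"
    using has_tt_embedding by blast
  have arcs: "(f i, f j) \<in> parcs D \<longleftrightarrow> i < j" if "i \<in> {1..t}" "j \<in> {1..t}" for i j
    using that f(2)[of i j] f(2)[of j i] D.no_digon[of "f j" "f i"] irr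
    by (cases i j rule: linorder_cases) auto
  have "\<not> H_free D (TT t)"
  proof (rule not_H_free_if_embedding[of _ _ f])
    show "pair_wf_digraph D" by unfold_locales
    show "pair_wf_digraph (TT t)" by unfold_locales (auto simp: TT_def)
    show "inj_on f (pverts (TT t))"
    proof (rule inj_onI)
      fix i j assume "i \<in> pverts (TT t)" "j \<in> pverts (TT t)" "f i = f j"
      then show "i = j" using arcs[of i j] arcs[of j i] irr
        by (cases i j rule: linorder_cases) (auto simp: TT_def)
    qed
  qed (use f(1) arcs in \<open>auto simp: TT_def\<close>)
  with free show False by blast
qed

section \<open>Ramsey bound and conclusion\<close>

lemma stable_set_ramsey:
  obtains ram :: "nat \<Rightarrow> nat" where
    "\<And>(E::'a rel) V n S. E \<subseteq> V \<times> V \<Longrightarrow> (\<And>v. (v, v) \<notin> E) \<Longrightarrow> \<not> has_tt E V t \<Longrightarrow>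
      finite S \<Longrightarrow> ram n \<le> card S \<Longrightarrow> \<exists>I\<subseteq>S. card I = n \<and> stable_set E I"
proof -
  \<comment> \<open>The bound is fixed before any digraph, so one \<open>ram\<close> serves all
    \<open>E\<close>.\<close>
  have "\<exists>N. \<forall>(S::'a set) (F::'a set set). finite S \<and> card S \<ge> N \<longrightarrow>
    (\<exists>K\<subseteq>S. card K = 2 ^ t + 1 \<and> clique K F \<or> card K = n \<and> indep K F)" for n
    using ramsey2[of "2 ^ t + 1" n] by blast
  then obtain ram where ram: "\<And>n (S::'a set) (F::'a set set). finite S \<and> card S \<ge> ram n \<longrightarrow>
    (\<exists>K\<subseteq>S. card K = 2 ^ t + 1 \<and> clique K F \<or> card K = n \<and> indep K F)"
    by metis
  show ?thesis
  proof (rule that[of ram])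
    fix E :: "'a rel" and V n and S :: "'a set"
    assume E: "E \<subseteq> V \<times> V" "\<And>v. (v, v) \<notin> E" and tt: "\<not> has_tt E V t"
      and S: "finite S" "ram n \<le> card S"
    define F where "F = {{u, v} |u v. (u, v) \<in> E}"
    have F: "{u, v} \<in> F \<longleftrightarrow> (u, v) \<in> E \<or> (v, u) \<in> E" for u v
      by (auto simp: F_def doubleton_eq_iff)
    obtain K where K: "K \<subseteq> S" "card K = 2 ^ t + 1 \<and> clique K F \<or> card K = n \<and> indep K F"
      using ram[of S n F] S by blast
    have "\<not> (card K = 2 ^ t + 1 \<and> clique K F)"
    proof
      assume *: "card K = 2 ^ t + 1 \<and> clique K F"
      then have adj: "(u, v) \<in> E \<or> (v, u) \<in> E" if "u \<in> K" "v \<in> K" "u \<noteq> v" for u v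
        using that by (auto simp: clique_def F)
      have finK: "finite K" using K(1) S(1) by (rule finite_subset)
      have "has_tt E K t" by (rule has_tt_tournament[OF finK]) (use * adj in auto)
      \<comment> \<open>\<open>S\<close> may reach beyond \<open>V\<close>. The extra vertex in
        \<open>2 ^ t + 1\<close> ensures that \<open>K\<close> has two vertices, so each has a
        neighbour in \<open>K\<close> and lies in \<open>V\<close>.\<close>
      moreover have "K \<subseteq> V"
      proof
        fix u assume u: "u \<in> K"
        have "K \<noteq> {u}" using * by auto
        then obtain v where "v \<in> K" "u \<noteq> v" using u by blast
        then show "u \<in> V" using adj[OF u] E(1) by blast
      qed
      ultimately show False using tt has_tt_mono[of E K t E V] by blast
    qed
    then show "\<exists>I\<subseteq>S. card I = n \<and> stable_set E I"
      using K E(2) unfolding indep_def F stable_set_def by (intro exI[of _ K]) metis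
  qed
qed

lemma dichromatic_number_le:
  assumes "dicol (parcs D) (pverts D) c"
  shows "dichromatic_number D \<le> c"
proof -
  obtain f where f: "\<forall>v\<in>pverts D. f v < c"
      "acyclic {(u, v) \<in> parcs D. u \<in> pverts D \<and> v \<in> pverts D \<and> f u = f v}"
    using assms unfolding dicol_def by blast
  \<comment> \<open>Empty colour classes are removed because a partition has no empty part.\<close>
  define P where "P = (\<lambda>i. {v \<in> pverts D. f v = i}) ` {..<c} - {{}}"
  have "card P \<le> card ((\<lambda>i. {v \<in> pverts D. f v = i}) ` {..<c})"
    unfolding P_def by (intro card_mono) auto
  also have "\<dots> \<le> c" using card_image_le[of "{..<c}" "\<lambda>i. {v \<in> pverts D. f v = i}"] by simp
  finally have "card P \<le> c" .
  moreover have "partition_on (pverts D) P"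
    using f(1) by (intro partition_onI) (auto simp: P_def disjnt_def)
  moreover have "acyclic (arcs_ends (with_proj D \<restriction> S))" if "S \<in> P" for S
  proof -
    obtain i where "S = {v \<in> pverts D. f v = i}" using \<open>S \<in> P\<close> by (auto simp: P_def)
    then have "arcs_ends (with_proj D \<restriction> S)
        \<subseteq> {(u, v) \<in> parcs D. u \<in> pverts D \<and> v \<in> pverts D \<and> f u = f v}"
      by (auto simp: arcs_ends_conv)
    with f(2) show ?thesis by (rule acyclic_subset)
  qed
  ultimately have "dichromatic_number D \<le> card P"
    unfolding dichromatic_number_def by (intro Least_le) blast
  with \<open>card P \<le> c\<close> show ?thesis by simp
qed

theorem theorem1p16:
  fixes r s t :: nat and B B' :: "nat pair_pre_digraph"
  assumes "r \<ge> 1" and "s \<ge> 1" and "t \<ge> 1"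
    and "valid_orientation r B" and "valid_orientation s B'"
    and "opposing B B'"
  shows "dichromatic_finite {B, B', TT t}"
proof -
  note B = valid_orientation_arcs[OF assms(4)] and B' = valid_orientation_arcs[OF assms(5)]
  \<comment> \<open>Passing to the converse of \<open>B'\<close> gives both brooms the arc from 2 to
    3 that \<open>broomless\<close> expects.\<close>
  have arc23: "(2, 3) \<in> parcs B" "(2, 3) \<in> (parcs B')\<inverse>"
    using assms(6) by (simp_all add: opposing_def)
  obtain b1 e1 where 1: "parcs B = broom_arcs r b1 e1"
    by (rule broom_arcs_cases[OF B(4,3) arc23(1) B(5)])
  have "(u, v) \<in> (parcs B')\<inverse> \<or> (v, u) \<in> (parcs B')\<inverse> \<longleftrightarrow> (u, v) \<in> parcs (broom s)" for u v
    using B'(4)[of u v] by auto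
  moreover have "(v, u) \<notin> (parcs B')\<inverse>" if "(u, v) \<in> (parcs B')\<inverse>" for u v
    using B'(3)[of v u] that by auto
  moreover have "(\<forall>i\<in>{1..s}. (3, 3 + i) \<in> (parcs B')\<inverse>) \<or> (\<forall>i\<in>{1..s}. (3 + i, 3) \<in> (parcs B')\<inverse>)"
    using B'(5) by auto
  ultimately obtain b2 e2 where 2: "(parcs B')\<inverse> = broom_arcs s b2 e2"
    using broom_arcs_cases[of "(parcs B')\<inverse>" s] arc23(2) by metis
  obtain ram :: "nat \<Rightarrow> nat" where ram:
    "\<And>(E::nat rel) V n S. E \<subseteq> V \<times> V \<Longrightarrow> (\<And>v. (v, v) \<notin> E) \<Longrightarrow> \<not> has_tt E V t \<Longrightarrow>
      finite S \<Longrightarrow> ram n \<le> card S \<Longrightarrow> \<exists>I\<subseteq>S. card I = n \<and> stable_set E I"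
    by (rule stable_set_ramsey[of t]) blast
  \<comment> \<open>The maximum makes one threshold serve both brooms, and \<open>Suc\<close> makes
    it positive.\<close>
  define R where "R = Suc (ram (max r s))"
  have "0 < R" by (simp add: R_def)
  from dicol_broomless[where 'a = nat and ram = ram and t = t and ?b1.0 = b1 and ?e1.0 = e1
      and ?b2.0 = b2 and ?e2.0 = e2, OF this]
  obtain c where c: "\<And>(E::nat rel) V. finite V \<Longrightarrow> E \<subseteq> V \<times> V \<Longrightarrow>
    (\<And>u v. (u, v) \<in> E \<Longrightarrow> (v, u) \<notin> E) \<Longrightarrow>
    broomless E R b1 e1 \<Longrightarrow> broomless (E\<inverse>) R b2 e2 \<Longrightarrow>
    (\<And>n S. finite S \<Longrightarrow> ram n \<le> card S \<Longrightarrow> \<exists>I\<subseteq>S. card I = n \<and> stable_set E I) \<Longrightarrow>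
    \<not> has_tt E V t \<Longrightarrow> dicol E V c"
    by metis
  have "dichromatic_number D \<le> c" if D: "oriented_digraph D" and free: "family_free D {B, B', TT t}"
    for D :: "nat pair_pre_digraph"
  proof -
    interpret D: oriented_digraph D by (rule D)
    have wf: "pair_wf_digraph D" by unfold_locales
    let ?E = "parcs D"
    have H_free: "H_free D B" "H_free D B'" "H_free D (TT t)"
      using free by (auto simp: family_free_def)
    have E: "finite (pverts D)" "finite ?E" "?E \<subseteq> pverts D \<times> pverts D"
      using D.pair_finite_verts D.pair_finite_arcs D.in_arcsD1 D.in_arcsD2 by auto
    then have field: "Field ?E \<subseteq> pverts D" by (auto simp: Field_def)
    have irr: "(v, v) \<notin> ?E" for v using D.no_digon by blast
    have tt: "\<not> has_tt ?E (pverts D) t" by (rule not_has_tt_if_TT_free[OF D H_free(3)])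
    note ram' = ram[OF E(3) irr tt]
    have indep: "\<exists>I\<subseteq>S. card I = n \<and> stable_set ?E I"
      if S: "finite S" "R \<le> card S" "n \<le> max r s" for S n
    proof -
      obtain I where I: "I \<subseteq> S" "card I = max r s" "stable_set ?E I"
        using ram'[OF S(1), of "max r s"] S(2) by (auto simp: R_def)
      obtain J where "J \<subseteq> I" "card J = n"
        using obtain_subset_with_card_n[of n I] I(2) S(3) by auto
      then show ?thesis using I by (intro exI[of _ J]) (auto simp: stable_set_def)
    qed
    have "broomless ?E R b1 e1"
    proof (rule ccontr)
      assume "\<not> ?thesis"
      then obtain f where f: "inj_on f {1..3 + r}" "f ` {1..3 + r} \<subseteq> Field ?E"
        "\<And>u v. u \<in> {1..3 + r} \<Longrightarrow> v \<in> {1..3 + r} \<Longrightarrow> (u, v) \<in> broom_arcs r b1 e1 \<longleftrightarrow> (f u, f v) \<in> ?E"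
        by (rule broom_embedding) (use D.no_digon E(2) indep in auto)
      have "\<not> H_free D B"
        by (rule not_H_free_if_embedding[OF wf B(1), of f]) (use f field 1 B(2) in auto)
      with H_free(1) show False by simp
    qed
    moreover have "broomless (?E\<inverse>) R b2 e2"
    proof (rule ccontr)
      assume "\<not> ?thesis"
      then obtain f where f: "inj_on f {1..3 + s}" "f ` {1..3 + s} \<subseteq> Field (?E\<inverse>)"
        "\<And>u v. u \<in> {1..3 + s} \<Longrightarrow> v \<in> {1..3 + s} \<Longrightarrow> (u, v) \<in> broom_arcs s b2 e2 \<longleftrightarrow> (f u, f v) \<in> ?E\<inverse>"
        by (rule broom_embedding) (use D.no_digon E(2) indep in auto)
      have "\<not> H_free D B'"
      proof (rule not_H_free_if_embedding[OF wf B'(1), of f])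
        fix u v assume "u \<in> pverts B'" "v \<in> pverts B'"
        \<comment> \<open>Both sides of the embedding are converse relations, hence the swapped
          arguments.\<close>
        then show "(u, v) \<in> parcs B' \<longleftrightarrow> (f u, f v) \<in> ?E"
          using f(3)[of v u] unfolding 2[symmetric] B'(2) by simp
      qed (use f field B'(2) in auto)
      with H_free(2) show False by simp
    qed
    ultimately have "dicol ?E (pverts D) c"
      by (intro c) (use E D.no_digon ram' tt in auto)
    then show ?thesis by (rule dichromatic_number_le)
  qed
  then show ?thesis unfolding dichromatic_finite_def by auto
qed

end
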